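(* Under the standing assumptions in the context, there are constants $c_{10},c_{11}>0$ such that the following holds. For $j=1,2$ let $\mathcal F_j\in\mathcal W'$ and $(\mathbf u_j,p_j)\in\mathcal W$ with $\mathcal A(\mathbf u_j,p_j)=\mathcal F_j$. Let $M=1+\sum_{j=1}^2(\|\pi_1\mathcal F_j\|_{V'}^{r-1}+\|\pi_2\mathcal F_j\|_{Z'})$, $\beta=\|\pi_1(\mathcal F_1-\mathcal F_2)\|_{V'}$, $\gamma=\|\pi_2(\mathcal F_1-\mathcal F_2)\|_{Z'}$. Then $$\|(\mathbf u_1,p_1)-(\mathbf u_2,p_2)\|_{\mathcal W}\le c_{10}\big(\beta+M^{s-2}\beta^{r-1}+\gamma+M^{r(s-2)}\gamma^{r-1}\big),$$ and $$\|(\mathbf u_1,p_1)-(\mathbf u_2,p_2)\|_{\mathcal W}\le c_{11}\big(1+\|\mathcal F_1\|_{\mathcal W'}+\|\mathcal F_2\|_{\mathcal W'}\big)^{r(s-2)}\big(\|\mathcal F_1-\mathcal F_2\|_{\mathcal W'}^{r-1}+\|\mathcal F_1-\mathcal F_2\|_{\mathcal W'}\big).$$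
   Context: $n\ge2$, $\Omega\subset\mathbb R^n$ open bounded with $C^1$ boundary. $F:\mathbb R^n\to\mathbb R^n$ satisfies $F(0)=0$ and, for constants $s>2$, $c_1,c_2>0$ and all $x,y$: $|F(x)-F(y)|\le c_1(1+|x|^{s-2}+|y|^{s-2})|x-y|$ and $(F(x)-F(y))\cdot(x-y)\ge c_2|x-y|^s$. Let $r=s/(s-1)$. $V=\mathbf W_s(\mathrm{div},\Omega)=\{\mathbf v\in(L^s(\Omega))^n:\operatorname{div}\mathbf v\in L^s(\Omega)\}$ with norm $(\|\mathbf v\|_{L^s}^s+\|\operatorname{div}\mathbf v\|_{L^s}^s)^{1/s}$, $Z=L^r(\Omega)$, and $\mathcal W=V\times Z$ with norm $\|(\mathbf u,p)\|_{\mathcal W}=\|\mathbf u\|_V+\|p\|_Z$. Set $a(\mathbf u,\mathbf v)=\int_\Omega F(\mathbf u)\cdot\mathbf v\,dx$, $b(\mathbf v,q)=\int_\Omega(\operatorname{div}\mathbf v)q\,dx$, and $\mathcal A:\mathcal W\to\mathcal W'$ by $\langle\mathcal A(\mathbf u,p),(\mathbf v,q)\rangle=a(\mathbf u,\mathbf v)-b(\mathbf v,p)+b(\mathbf u,q)$. For $\mathcal F\in\mathcal W'$, $\pi_1\mathcal F\in V'$ and $\pi_2\mathcal F\in Z'$ are $(\pi_1\mathcal F)(\mathbf v)=\mathcal F(\mathbf v,0)$ and $(\pi_2\mathcal F)(q)=\mathcal F(0,q)$. *)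

theory Defs
  imports "HOL-Analysis.Analysis"
begin

type_synonym ('n) vfun = "real^('n::finite) \<Rightarrow> real^('n::finite)"
type_synonym ('n) sfun = "real^('n::finite) \<Rightarrow> real"

fun iter_dderiv :: "(real^('n::finite)) list \<Rightarrow> ('n::finite) sfun \<Rightarrow> ('n::finite) sfun" where
  "iter_dderiv [] f = f"
| "iter_dderiv (d # ds) f = (\<lambda>x. frechet_derivative (iter_dderiv ds f) (at x) d)"

definition smooth_fun :: "('n::finite) sfun \<Rightarrow> bool" where
  "smooth_fun f \<longleftrightarrow> (\<forall>ds x. iter_dderiv ds f differentiable (at x))"

definition test_fun :: "(real^('n::finite)) set \<Rightarrow> ('n::finite) sfun \<Rightarrow> bool" where
  "test_fun \<Omega> \<phi> \<longleftrightarrow> smooth_fun \<phi> \<and> compact (closure {x. \<phi> x \<noteq> 0})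
      \<and> closure {x. \<phi> x \<noteq> 0} \<subseteq> \<Omega>"

definition C1_fun :: "('n::finite) sfun \<Rightarrow> bool" where
  "C1_fun g \<longleftrightarrow> (\<exists>D :: real^('n::finite) \<Rightarrow> ((real^('n::finite)) \<Rightarrow>\<^sub>L real).
      (\<forall>x. (g has_derivative blinfun_apply (D x)) (at x)) \<and> continuous_on UNIV D)"

text \<open>Locally, after a rotation, Omega lies on one side of the graph of a C1 function:
  near every boundary point there is a unit direction e and a C1 function g,
  constant along e (i.e. a function of the n-1 coordinates orthogonal to e),
  such that Omega is the part of the ball below the graph in direction e.\<close>
definition C1_boundary :: "(real^('n::finite)) set \<Rightarrow> bool" where
  "C1_boundary \<Omega> \<longleftrightarrow> (\<forall>x0\<in>frontier \<Omega>. \<exists>\<rho>>0. \<exists>e g. norm e = 1 \<and> C1_fun g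
      \<and> (\<forall>x t. g (x + t *\<^sub>R e) = g x)
      \<and> \<Omega> \<inter> ball x0 \<rho> = {x \<in> ball x0 \<rho>. x \<bullet> e < g x})"

definition in_Lp :: "real \<Rightarrow> (real^('n::finite)) set \<Rightarrow> (real^('n::finite) \<Rightarrow> 'b::euclidean_space) \<Rightarrow> bool" where
  "in_Lp p \<Omega> f \<longleftrightarrow> f \<in> borel_measurable (lebesgue_on \<Omega>)
      \<and> integrable (lebesgue_on \<Omega>) (\<lambda>x. norm (f x) powr p)"

definition Lp_norm :: "real \<Rightarrow> (real^('n::finite)) set \<Rightarrow> (real^('n::finite) \<Rightarrow> 'b::euclidean_space) \<Rightarrow> real" where
  "Lp_norm p \<Omega> f = (integral\<^sup>L (lebesgue_on \<Omega>) (\<lambda>x. norm (f x) powr p)) powr (1/p)"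

definition is_weak_div :: "(real^('n::finite)) set \<Rightarrow> ('n::finite) vfun \<Rightarrow> ('n::finite) sfun \<Rightarrow> bool" where
  "is_weak_div \<Omega> v g \<longleftrightarrow> g \<in> borel_measurable (lebesgue_on \<Omega>) \<and>
     (\<forall>\<phi>. test_fun \<Omega> \<phi> \<longrightarrow>
        integrable (lebesgue_on \<Omega>) (\<lambda>x. g x * \<phi> x) \<and>
        integrable (lebesgue_on \<Omega>) (\<lambda>x. frechet_derivative \<phi> (at x) (v x)) \<and>
        integral\<^sup>L (lebesgue_on \<Omega>) (\<lambda>x. frechet_derivative \<phi> (at x) (v x))
          = - integral\<^sup>L (lebesgue_on \<Omega>) (\<lambda>x. g x * \<phi> x))"

text \<open>(A representative of) the weak divergence; unique up to null sets.\<close>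
definition wdiv :: "(real^('n::finite)) set \<Rightarrow> ('n::finite) vfun \<Rightarrow> ('n::finite) sfun" where
  "wdiv \<Omega> v = (SOME g. is_weak_div \<Omega> v g)"

definition Wdiv_space :: "real \<Rightarrow> (real^('n::finite)) set \<Rightarrow> ('n::finite) vfun set" where
  "Wdiv_space s \<Omega> = {v. in_Lp s \<Omega> v \<and> (\<exists>g. is_weak_div \<Omega> v g \<and> in_Lp s \<Omega> g)}"

definition V_norm :: "real \<Rightarrow> (real^('n::finite)) set \<Rightarrow> ('n::finite) vfun \<Rightarrow> real" where
  "V_norm s \<Omega> v = (Lp_norm s \<Omega> v powr s + Lp_norm s \<Omega> (wdiv \<Omega> v) powr s) powr (1/s)"

definition W_space :: "real \<Rightarrow> (real^('n::finite)) set \<Rightarrow> (('n::finite) vfun \<times> ('n::finite) sfun) set" where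
  "W_space s \<Omega> = Wdiv_space s \<Omega> \<times> {q. in_Lp (s/(s-1)) \<Omega> q}"

definition W_norm :: "real \<Rightarrow> (real^('n::finite)) set \<Rightarrow> ('n::finite) vfun \<times> ('n::finite) sfun \<Rightarrow> real" where
  "W_norm s \<Omega> w = V_norm s \<Omega> (fst w) + Lp_norm (s/(s-1)) \<Omega> (snd w)"

definition W_dual :: "real \<Rightarrow> (real^('n::finite)) set \<Rightarrow> (('n::finite) vfun \<times> ('n::finite) sfun \<Rightarrow> real) set" where
  "W_dual s \<Omega> = {L. (\<forall>v q v' q' a b. (v, q) \<in> W_space s \<Omega> \<longrightarrow> (v', q') \<in> W_space s \<Omega> \<longrightarrow>
        L (\<lambda>x. a *\<^sub>R v x + b *\<^sub>R v' x, \<lambda>x. a * q x + b * q' x) = a * L (v, q) + b * L (v', q'))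
     \<and> (\<exists>C. \<forall>w\<in>W_space s \<Omega>. \<bar>L w\<bar> \<le> C * W_norm s \<Omega> w)}"

definition dual_norm :: "'a set \<Rightarrow> ('a \<Rightarrow> real) \<Rightarrow> ('a \<Rightarrow> real) \<Rightarrow> real" where
  "dual_norm S N L = Sup ((\<lambda>x. \<bar>L x\<bar>) ` {x \<in> S. N x \<le> 1})"

definition W'_norm :: "real \<Rightarrow> (real^('n::finite)) set \<Rightarrow> (('n::finite) vfun \<times> ('n::finite) sfun \<Rightarrow> real) \<Rightarrow> real" where
  "W'_norm s \<Omega> L = dual_norm (W_space s \<Omega>) (W_norm s \<Omega>) L"

definition V'_norm_pi1 :: "real \<Rightarrow> (real^('n::finite)) set \<Rightarrow> (('n::finite) vfun \<times> ('n::finite) sfun \<Rightarrow> real) \<Rightarrow> real" where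
  "V'_norm_pi1 s \<Omega> L = dual_norm (Wdiv_space s \<Omega>) (V_norm s \<Omega>) (\<lambda>v. L (v, \<lambda>x. 0))"

definition Z'_norm_pi2 :: "real \<Rightarrow> (real^('n::finite)) set \<Rightarrow> (('n::finite) vfun \<times> ('n::finite) sfun \<Rightarrow> real) \<Rightarrow> real" where
  "Z'_norm_pi2 s \<Omega> L = dual_norm {q. in_Lp (s/(s-1)) \<Omega> q} (Lp_norm (s/(s-1)) \<Omega>) (\<lambda>q. L (\<lambda>x. 0, q))"

definition a_form :: "(real^('n::finite)) set \<Rightarrow> (real^('n::finite) \<Rightarrow> real^('n::finite)) \<Rightarrow> ('n::finite) vfun \<Rightarrow> ('n::finite) vfun \<Rightarrow> real" where
  "a_form \<Omega> F u v = integral\<^sup>L (lebesgue_on \<Omega>) (\<lambda>x. F (u x) \<bullet> v x)"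

definition b_form :: "(real^('n::finite)) set \<Rightarrow> ('n::finite) vfun \<Rightarrow> ('n::finite) sfun \<Rightarrow> real" where
  "b_form \<Omega> v q = integral\<^sup>L (lebesgue_on \<Omega>) (\<lambda>x. wdiv \<Omega> v x * q x)"

definition solves_A :: "real \<Rightarrow> (real^('n::finite)) set \<Rightarrow> (real^('n::finite) \<Rightarrow> real^('n::finite)) \<Rightarrow> ('n::finite) vfun \<Rightarrow> ('n::finite) sfun
     \<Rightarrow> (('n::finite) vfun \<times> ('n::finite) sfun \<Rightarrow> real) \<Rightarrow> bool" where
  "solves_A s \<Omega> F u p L \<longleftrightarrow> (\<forall>v q. (v, q) \<in> W_space s \<Omega> \<longrightarrow>
      a_form \<Omega> F u v - b_form \<Omega> v p + b_form \<Omega> u q = L (v, q))"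

end

theory Submission
  imports Defs
begin

text \<open>
  Write w = u1 - u2 and q = p1 - p2, with r conjugate to s. Testing the second equation with
  |div w|^(s-2) div w gives ||div w|| \<le> \<gamma>. Since div : V \<rightarrow> L^s has a bounded right inverse,
  testing the first equation with some v such that div v = |q|^(r-2) q gives
  ||q|| \<le> K ((1 + ||u1|| + ||u2||)^(s-2) ||w|| + \<beta>), and monotonicity tested with (w, q) gives
  c2 ||w||^s \<le> \<beta> (||w|| + \<gamma>) + \<gamma> ||q||. Comparing one solution with the zero solution, these three
  inequalities bound ||u_j|| by a multiple of M; used a second time, they give the first estimate.
  There the term M^(s-2) \<gamma> is absorbed by M^(r(s-2)) \<gamma>^(r-1), because \<gamma> \<le> M and s - r = r (s - 2).
  The right inverse integrates g, extended by zero, along one fixed direction over a length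
  exceeding the diameter of \<Omega>.
\<close>

section \<open>Smooth bump functions\<close>

text \<open>\<open>wdiv\<close> is picked by \<open>SOME\<close>, so even linearity of the
  divergence holds only almost everywhere and rests on uniqueness of the weak divergence; the bump
  functions serve this purpose. The test function |f|^(s-2) f has L^r norm ||f||^(s-1) while its
  pairing with f is ||f||^s, so exactly one power of the norm survives cancellation. The obstacle is
  the growth factor (1 + ||u1|| + ||u2||)^(s-2): it involves the unknowns and must be bounded by the
  data before the difference can be estimated. M is the right scale because (r-1)(s-1) = 1: data of
  size M^(s-1) on V and of size M on Z correspond to velocities of size M. Apart from the product
  \<beta> \<gamma>, the energy inequality makes ||w||^(s-1) of order \<beta> + M^(s-2) \<gamma>,
  hence ||w|| of order \<beta>^(r-1) + M^((s-2)(r-1)) \<gamma>^(r-1), and the pressure bound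
  multiplies this by M^(s-2). As (s-2) + (s-2)(r-1) = r(s-2), both exponents of M in the first
  estimate arise here.\<close>

definition flat_exp :: "nat \<Rightarrow> real \<Rightarrow> real \<Rightarrow> real" where
  "flat_exp m k t = (if t > 0 then inverse t ^ m * exp (- (k * inverse t)) else 0)"

lemma power_times_exp_at_top:
  fixes k :: real
  assumes "k > 0"
  shows "((\<lambda>y. y ^ m * exp (- (k * y))) \<longlongrightarrow> 0) at_top"
proof -
  have "((\<lambda>y. (k * y) ^ m / exp (k * y)) \<longlongrightarrow> 0) at_top"
    by (rule filterlim_compose[OF tendsto_power_div_exp_0])
       (rule filterlim_tendsto_pos_mult_at_top[OF tendsto_const assms filterlim_ident])
  then have "((\<lambda>y. (1 / k ^ m) * ((k * y) ^ m / exp (k * y))) \<longlongrightarrow> (1 / k ^ m) * 0) at_top"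
    by (intro tendsto_intros)
  moreover have "(\<lambda>y. (1 / k ^ m) * ((k * y) ^ m / exp (k * y))) = (\<lambda>y. y ^ m * exp (- (k * y)))"
    using assms by (auto simp: fun_eq_iff power_mult_distrib exp_minus field_simps)
  ultimately show ?thesis by simp
qed

lemma flat_exp_tendsto_0:
  assumes "k > 0"
  shows "(flat_exp m k \<longlongrightarrow> 0) (at 0)"
proof (subst filterlim_at_split, intro conjI)
  have "\<forall>\<^sub>F x in at_left 0. 0 = flat_exp m k x"
    by (auto simp: flat_exp_def eventually_at_left_field intro: exI[of _ "-1"])
  then show "(flat_exp m k \<longlongrightarrow> 0) (at_left 0)"
    by (rule tendsto_eventually[OF eventually_mono]) simp
  have "((\<lambda>t::real. inverse t ^ m * exp (- (k * inverse t))) \<longlongrightarrow> 0) (at_right 0)"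
    by (rule filterlim_compose[OF power_times_exp_at_top[OF assms] filterlim_inverse_at_top_right])
  moreover have "\<forall>\<^sub>F x in at_right 0. inverse x ^ m * exp (- (k * inverse x)) = flat_exp m k x"
    by (auto simp: flat_exp_def eventually_at_right_field intro: exI[of _ 1])
  ultimately show "(flat_exp m k \<longlongrightarrow> 0) (at_right 0)"
    by (rule Lim_transform_eventually)
qed

lemma flat_exp_has_derivative:
  assumes "k > 0"
  shows "(flat_exp m k has_real_derivative (k * flat_exp (m + 2) k t - real m * flat_exp (m + 1) k t)) (at t)"
proof -
  consider "t < 0" | "t = 0" | "t > 0" by linarith
  then show ?thesis
  proof cases
    case 1
    have "((\<lambda>_. 0) has_real_derivative 0) (at t)" by simp
    then have "(flat_exp m k has_real_derivative 0) (at t)"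
      by (rule has_field_derivative_transform_within_open[where S="{..<0}"])
         (use 1 in \<open>auto simp: flat_exp_def\<close>)
    with 1 show ?thesis by (simp add: flat_exp_def)
  next
    case 2
    have "(flat_exp (m + 1) k \<longlongrightarrow> 0) (at 0)"
      by (rule flat_exp_tendsto_0[OF assms])
    \<comment> \<open>The difference quotient at 0 is again a member of the family, so its limit is
      already known.\<close>
    moreover have "flat_exp (m + 1) k = (\<lambda>h. (flat_exp m k (0 + h) - flat_exp m k 0) / h)"
      by (auto simp: flat_exp_def fun_eq_iff field_simps)
    ultimately have "(flat_exp m k has_real_derivative 0) (at 0)"
      by (simp add: DERIV_def)
    with 2 show ?thesis by (simp add: flat_exp_def)
  next
    case 3
    have "((\<lambda>t. inverse t ^ m * exp (- (k * inverse t))) has_real_derivative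
        (k * flat_exp (m + 2) k t - real m * flat_exp (m + 1) k t)) (at t)"
      using 3
      \<comment> \<open>The case split avoids the truncated exponent m - 1 of the power
        rule.\<close>
      by (cases m)
         (auto intro!: derivative_eq_intros simp: flat_exp_def field_simps power2_eq_square,
          metis One_nat_def mult.commute power_minus_mult neq0_conv)
    then show ?thesis
      by (rule has_field_derivative_transform_within_open[where S="{0<..}"])
         (use 3 in \<open>auto simp: flat_exp_def\<close>)
  qed
qed

text \<open>This class is closed under directional derivatives, since the derivative of
  \<^term>\<open>flat_exp m k\<close> is a combination of \<^term>\<open>flat_exp (m + 2) k\<close> and
  \<^term>\<open>flat_exp (m + 1) k\<close>; hence its members are smooth.\<close>

inductive flat_generated :: "('n::finite) sfun \<Rightarrow> bool" where
  const: "flat_generated (\<lambda>x. c)"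
| flat: "k > 0 \<Longrightarrow> flat_generated (\<lambda>x. flat_exp m k (x \<bullet> e + c))"
| add: "flat_generated f \<Longrightarrow> flat_generated g \<Longrightarrow> flat_generated (\<lambda>x. f x + g x)"
| mult: "flat_generated f \<Longrightarrow> flat_generated g \<Longrightarrow> flat_generated (\<lambda>x. f x * g x)"

lemma flat_generated_derivative:
  assumes "flat_generated f"
  shows "\<exists>D. (\<forall>x. (f has_derivative D x) (at x)) \<and> (\<forall>d. flat_generated (\<lambda>x. D x d))"
  using assms
proof induction
  case (const c)
  then show ?case
    by (intro exI[of _ "\<lambda>x d. 0"]) (auto intro: flat_generated.const)
next
  case (flat k m e c)
  \<comment> \<open>The minus sign is written as a product with a constant, because the class has
    rules only for sums and products.\<close>
  let ?D = "\<lambda>x d. (k * flat_exp (m + 2) k (x \<bullet> e + c) + (- real m) * flat_exp (m + 1) k (x \<bullet> e + c)) * (d \<bullet> e)"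
  have "((\<lambda>x. flat_exp m k (x \<bullet> e + c)) has_derivative ?D x) (at x)" for x
  proof -
    have "((\<lambda>x. x \<bullet> e + c) has_derivative (\<lambda>d. d \<bullet> e)) (at x)"
      by (auto intro!: derivative_eq_intros)
    from has_derivative_compose[OF this flat_exp_has_derivative[OF flat, unfolded has_field_derivative_def]]
    show ?thesis by simp
  qed
  moreover have "flat_generated (\<lambda>x. ?D x d)" for d
    by (intro flat_generated.intros flat)
  ultimately show ?case by (intro exI[of _ ?D]) blast
next
  case (add f g)
  then obtain D E where "\<And>x. (f has_derivative D x) (at x)" "\<And>d. flat_generated (\<lambda>x. D x d)"
    "\<And>x. (g has_derivative E x) (at x)" "\<And>d. flat_generated (\<lambda>x. E x d)" by blast
  then show ?case
    by (intro exI[of _ "\<lambda>x d. D x d + E x d"])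
       (auto intro!: has_derivative_add flat_generated.intros)
next
  case (mult f g)
  then obtain D E where "\<And>x. (f has_derivative D x) (at x)" "\<And>d. flat_generated (\<lambda>x. D x d)"
    "\<And>x. (g has_derivative E x) (at x)" "\<And>d. flat_generated (\<lambda>x. E x d)" by blast
  with mult.hyps show ?case
    by (intro exI[of _ "\<lambda>x d. f x * E x d + D x d * g x"])
       (auto intro!: has_derivative_mult flat_generated.intros)
qed

lemma flat_generated_iter_dderiv:
  "flat_generated f \<Longrightarrow> flat_generated (iter_dderiv ds f)"
proof (induction ds)
  case (Cons d ds)
  then obtain D where D: "\<And>x. (iter_dderiv ds f has_derivative D x) (at x)"
    "flat_generated (\<lambda>x. D x d)"
    using flat_generated_derivative by blast
  from D(1) have "frechet_derivative (iter_dderiv ds f) (at x) = D x" for x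
    by (metis frechet_derivative_at)
  with D(2) show ?case by simp
qed simp

lemma flat_generated_smooth: "flat_generated f \<Longrightarrow> smooth_fun f"
  unfolding smooth_fun_def
  using flat_generated_iter_dderiv flat_generated_derivative by (metis differentiableI)

lemma flat_generated_prod:
  "finite A \<Longrightarrow> (\<And>i. i \<in> A \<Longrightarrow> flat_generated (f i)) \<Longrightarrow> flat_generated (\<lambda>x. \<Prod>i\<in>A. f i x)"
  by (induction A rule: finite_induct) (auto intro: flat_generated.intros)

text \<open>Each coordinate contributes one factor vanishing at the lower face of the box and one at
  the upper face. The parameter \<open>k\<close> is later sent to 0, which turns the bump into the
  indicator of the open box.\<close>

definition bump :: "real \<Rightarrow> real^('n::finite) \<Rightarrow> real^'n \<Rightarrow> ('n::finite) sfun" where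
  "bump k a b x = (\<Prod>i\<in>Basis. flat_exp 0 k (x \<bullet> i + - (a \<bullet> i)) * flat_exp 0 k (x \<bullet> (- i) + b \<bullet> i))"

lemma flat_generated_bump: "k > 0 \<Longrightarrow> flat_generated (bump k a b)"
  unfolding bump_def by (intro flat_generated_prod flat_generated.intros) auto

lemma bump_eq_0_iff: "bump k a b x = 0 \<longleftrightarrow> x \<notin> box a b"
proof -
  have "bump k a b x = 0 \<longleftrightarrow> (\<exists>i\<in>Basis. \<not> (a \<bullet> i < x \<bullet> i \<and> x \<bullet> i < b \<bullet> i))"
    unfolding bump_def by (subst prod_zero_iff) (force simp: flat_exp_def not_less)+
  then show ?thesis by (auto simp: mem_box)
qed

lemma bump_nonneg: "bump k a b x \<ge> 0"
  unfolding bump_def by (intro prod_nonneg) (auto simp: flat_exp_def)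

lemma bump_le_1: "k > 0 \<Longrightarrow> bump k a b x \<le> 1"
  unfolding bump_def by (intro prod_le_1) (auto simp: flat_exp_def intro!: mult_le_one)

text \<open>Inside the box every factor is exp (- k / t) with t > 0 fixed and k tending to 0;
  outside, some factor is zero for every k.\<close>

lemma bump_tendsto_indicator:
  "(\<lambda>j. bump (1 / real (Suc j)) a b x) \<longlonglongrightarrow> indicator (box a b) x"
proof (cases "x \<in> box a b")
  case False
  then have "bump (1 / real (Suc j)) a b x = 0" for j by (simp add: bump_eq_0_iff)
  with False show ?thesis by simp
next
  case True
  have lim: "(\<lambda>j. flat_exp 0 (1 / real (Suc j)) t) \<longlonglongrightarrow> 1" if "t > 0" for t :: real
  proof -
    have "(\<lambda>j. exp (- (1 / real (Suc j) * inverse t))) \<longlonglongrightarrow> exp (- (0 * inverse t))"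
      by (intro tendsto_intros lim_1_over_n[THEN LIMSEQ_Suc])
    with that show ?thesis by (simp add: flat_exp_def)
  qed
  have "(\<lambda>j. bump (1 / real (Suc j)) a b x) \<longlonglongrightarrow> (\<Prod>i\<in>(Basis::(real^'a) set). 1 * 1)"
    unfolding bump_def using True by (intro tendsto_prod tendsto_mult lim) (auto simp: mem_box)
  with True show ?thesis by simp
qed

lemma flat_generated_continuous: "flat_generated f \<Longrightarrow> continuous_on A f"
  by (meson flat_generated_derivative has_derivative_continuous continuous_at_imp_continuous_on)

text \<open>The bump alone supplies the compact support, so the other factor may be a constant or a
  second bump over a box that leaves \<Omega>.\<close>

lemma test_fun_bump_mult:
  assumes "k > 0" "flat_generated f" "cbox a b \<subseteq> \<Omega>"
  shows "test_fun \<Omega> (\<lambda>x. bump k a b x * f x)"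
proof -
  have "closure {x. bump k a b x * f x \<noteq> 0} \<subseteq> cbox a b"
    using box_subset_cbox by (intro closure_minimal) (auto simp: bump_eq_0_iff)
  moreover from this have "compact (closure {x. bump k a b x * f x \<noteq> 0})"
    by (meson bounded_cbox bounded_subset closed_closure compact_eq_bounded_closed)
  ultimately show ?thesis
    unfolding test_fun_def using assms
    by (auto intro!: flat_generated_smooth flat_generated.intros flat_generated_bump)
qed

section \<open>Weak divergence\<close>

text \<open>Multiplying \<open>g\<close> by one fixed bump makes it globally integrable; letting further bumps tend to
  indicators of boxes, all its box integrals vanish, and the Lebesgue differentiation theorem applies.\<close>

lemma AE_eq_0_of_test_functions_box:
  fixes g :: "('n::finite) sfun"
  assumes \<Omega>: "open \<Omega>"
    and int: "\<And>\<phi>. test_fun \<Omega> \<phi> \<Longrightarrow> integrable (lebesgue_on \<Omega>) (\<lambda>x. g x * \<phi> x)"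
    and zero: "\<And>\<phi>. test_fun \<Omega> \<phi> \<Longrightarrow> integral\<^sup>L (lebesgue_on \<Omega>) (\<lambda>x. g x * \<phi> x) = 0"
    and ab: "cbox a b \<subseteq> \<Omega>"
  shows "AE x in lebesgue. x \<in> cbox a b \<longrightarrow> g x = 0"
proof -
  have [measurable]: "\<Omega> \<in> sets lebesgue" using \<Omega> by auto
  define f where "f x = indicator \<Omega> x * (g x * bump 1 a b x)" for x
  have test: "test_fun \<Omega> (\<lambda>x. bump 1 a b x * h x)" if "flat_generated h" for h
    using that ab by (intro test_fun_bump_mult) auto
  have f_int: "integrable lebesgue f"
    using int[OF test[OF flat_generated.const[of 1]]] by (simp add: integrable_restrict_space f_def[abs_def])
  \<comment> \<open>The box is arbitrary and need not lie in \<Omega>, since f already carries the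
    bump over \<open>cbox a b\<close>.\<close>
  have box0: "integral (cbox c d) f = 0" for c d
  proof -
    let ?F = "\<lambda>j x. f x * bump (1 / real (Suc j)) c d x"
    have F_bound: "norm (?F j x) \<le> norm (f x)" for j x
      using bump_nonneg[of "1 / real (Suc j)" c d x] bump_le_1[of "1 / real (Suc j)" c d x]
      by (simp add: abs_mult mult_left_le)
    have F0: "integral\<^sup>L lebesgue (?F j) = 0" for j
    proof -
      have gen: "flat_generated (bump (1 / real (Suc j)) c d)"
        by (rule flat_generated_bump) simp
      show ?thesis
        using zero[OF test[OF gen]] by (simp add: integral_restrict_space f_def mult_ac)
    qed
    have "(\<lambda>j. integral\<^sup>L lebesgue (?F j)) \<longlonglongrightarrow> integral\<^sup>L lebesgue (\<lambda>x. f x * indicator (box c d) x)"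
    proof (rule integral_dominated_convergence[where w="\<lambda>x. norm (f x)"])
      show "(\<lambda>x. f x * indicator (box c d) x) \<in> borel_measurable lebesgue"
        using f_int by (intro borel_measurable_times borel_measurable_indicator) auto
      show "?F j \<in> borel_measurable lebesgue" for j
      proof (intro borel_measurable_times)
        have "bump (1 / real (Suc j)) c d \<in> borel_measurable borel"
          by (intro borel_measurable_continuous_onI flat_generated_continuous flat_generated_bump) simp
        then show "bump (1 / real (Suc j)) c d \<in> borel_measurable lebesgue"
          by (simp add: measurable_completion)
      qed (use f_int in auto)
      show "AE x in lebesgue. (\<lambda>j. ?F j x) \<longlonglongrightarrow> f x * indicator (box c d) x"
        by (intro AE_I2 tendsto_mult tendsto_const bump_tendsto_indicator)
    qed (use f_int F_bound in auto)
    with F0 have 0: "integral\<^sup>L lebesgue (\<lambda>x. f x * indicator (box c d) x) = 0"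
      by (simp add: LIMSEQ_const_iff)
    have "set_integrable lebesgue (box c d) f"
      unfolding set_integrable_def using f_int by (intro integrable_mult_indicator) auto
    from set_lebesgue_integral_eq_integral(2)[OF this] 0 show ?thesis
      by (simp add: set_lebesgue_integral_def mult.commute integral_open_interval)
  qed
  have "f integrable_on cbox c d" for c d
    using f_int integrable_on_lebesgue integrable_on_subcbox by blast
  then obtain N where N: "negligible N"
    "\<And>x e. x \<notin> N \<Longrightarrow> 0 < e \<Longrightarrow> \<exists>d>0. \<forall>h. 0 < h \<and> h < d \<longrightarrow>
        norm (integral (cbox x (x + h *\<^sub>R One)) f /\<^sub>R h ^ DIM(real^'n) - f x) < e"
    using integrable_ccontinuous_explicit[of f] by metis
  have "f x = 0" if "x \<notin> N" for x
  proof (rule ccontr)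
    \<comment> \<open>All averages over cubes vanish, so the tolerance \<open>norm (f x)\<close>
      would give norm (f x) < norm (f x) for every small side length h.\<close>
    assume "f x \<noteq> 0"
    with N(2)[OF that, of "norm (f x)"] obtain d :: real where "d > 0"
      "\<forall>h>0. \<not> h < d"
      by (auto simp: box0)
    then show False using dense by blast
  qed
  then have "AE x in lebesgue. f x = 0"
    using N(1) by (intro AE_I'[of N]) (auto simp: negligible_iff_null_sets)
  \<comment> \<open>On the faces the bump vanishes and f = 0 says nothing about g; but the faces
    form a null set.\<close>
  moreover have "AE x in lebesgue. x \<notin> cbox a b - box a b"
    using negligible_frontier_interval by (intro AE_not_in) (simp add: negligible_iff_null_sets)
  ultimately show ?thesis
  proof eventually_elim
    case (elim x)
    then show ?case
      using ab bump_eq_0_iff[of 1 a b x] by (auto simp: f_def indicator_def split: if_splits)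
  qed
qed

text \<open>An open set is a countable union of closed boxes, so the exceptional null sets of the
  boxes add up to a null set.\<close>

lemma AE_eq_0_of_test_functions:
  fixes g :: "('n::finite) sfun"
  assumes \<Omega>: "open \<Omega>"
    and int: "\<And>\<phi>. test_fun \<Omega> \<phi> \<Longrightarrow> integrable (lebesgue_on \<Omega>) (\<lambda>x. g x * \<phi> x)"
    and zero: "\<And>\<phi>. test_fun \<Omega> \<phi> \<Longrightarrow> integral\<^sup>L (lebesgue_on \<Omega>) (\<lambda>x. g x * \<phi> x) = 0"
  shows "AE x in lebesgue_on \<Omega>. g x = 0"
proof -
  obtain \<D> where \<D>: "countable \<D>" "\<D> \<subseteq> Pow \<Omega>" "\<And>X. X \<in> \<D> \<Longrightarrow> \<exists>a b. X = cbox a b" "\<Union>\<D> = \<Omega>"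
    using open_countable_Union_open_cbox[OF \<Omega>] by blast
  have "AE x in lebesgue. \<forall>X\<in>\<D>. x \<in> X \<longrightarrow> g x = 0"
  proof (subst AE_ball_countable[OF \<D>(1)], rule ballI)
    fix X assume "X \<in> \<D>"
    then obtain a b where "X = cbox a b" "cbox a b \<subseteq> \<Omega>" using \<D> by blast
    then show "AE x in lebesgue. x \<in> X \<longrightarrow> g x = 0"
      using AE_eq_0_of_test_functions_box[OF assms] by simp
  qed
  then have "AE x in lebesgue. x \<in> \<Omega> \<longrightarrow> g x = 0"
    by eventually_elim (use \<D>(4) in blast)
  with \<Omega> show ?thesis by (subst AE_restrict_space_iff) auto
qed

text \<open>Both candidates have the same integral against every test function, so their difference
  is annihilated by all of them. This makes the choice hidden in \<open>wdiv\<close> harmless for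
  norms and integrals.\<close>

lemma weak_div_unique:
  assumes "open \<Omega>" "is_weak_div \<Omega> v g" "is_weak_div \<Omega> v h"
  shows "AE x in lebesgue_on \<Omega>. g x = h x"
proof -
  have "AE x in lebesgue_on \<Omega>. g x - h x = 0"
    using assms by (intro AE_eq_0_of_test_functions)
      (auto simp: is_weak_div_def left_diff_distrib)
  then show ?thesis by simp
qed

lemma is_weak_div_wdiv: "is_weak_div \<Omega> v g \<Longrightarrow> is_weak_div \<Omega> v (wdiv \<Omega> v)"
  unfolding wdiv_def by (rule someI[where P="is_weak_div \<Omega> v"])

lemma wdiv_AE_eq:
  "open \<Omega> \<Longrightarrow> is_weak_div \<Omega> v g \<Longrightarrow> AE x in lebesgue_on \<Omega>. wdiv \<Omega> v x = g x"
  using weak_div_unique is_weak_div_wdiv by blast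

lemma is_weak_div_lincomb:
  assumes "is_weak_div \<Omega> u g" "is_weak_div \<Omega> v h"
  shows "is_weak_div \<Omega> (\<lambda>x. a *\<^sub>R u x + b *\<^sub>R v x) (\<lambda>x. a * g x + b * h x)"
proof -
  have lin: "frechet_derivative \<phi> (at x) (a *\<^sub>R u x + b *\<^sub>R v x)
      = a * frechet_derivative \<phi> (at x) (u x) + b * frechet_derivative \<phi> (at x) (v x)"
    if "test_fun \<Omega> \<phi>" for \<phi> x
  proof -
    \<comment> \<open>The empty list in \<open>smooth_fun\<close> gives differentiability of \<phi>
      itself, without which \<open>frechet_derivative\<close> is not known to be linear.\<close>
    have "iter_dderiv [] \<phi> differentiable (at x)"
      using that unfolding test_fun_def smooth_fun_def by blast
    then have "linear (frechet_derivative \<phi> (at x))"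
      by (simp add: linear_frechet_derivative)
    then show ?thesis by (simp add: linear_add linear_scale)
  qed
  show ?thesis
    unfolding is_weak_div_def
  proof (intro conjI allI impI)
    show "(\<lambda>x. a * g x + b * h x) \<in> borel_measurable (lebesgue_on \<Omega>)"
      using assms unfolding is_weak_div_def
      by (intro borel_measurable_add borel_measurable_times borel_measurable_const) blast+
    fix \<phi> assume t: "test_fun \<Omega> \<phi>"
    note gh = assms[unfolded is_weak_div_def, THEN conjunct2, rule_format, OF t]
    from gh show "integrable (lebesgue_on \<Omega>) (\<lambda>x. (a * g x + b * h x) * \<phi> x)"
      by (auto simp: distrib_right mult.assoc)
    from gh show "integrable (lebesgue_on \<Omega>) (\<lambda>x. frechet_derivative \<phi> (at x) (a *\<^sub>R u x + b *\<^sub>R v x))"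
      by (auto simp: lin[OF t])
    from gh show "integral\<^sup>L (lebesgue_on \<Omega>) (\<lambda>x. frechet_derivative \<phi> (at x) (a *\<^sub>R u x + b *\<^sub>R v x))
        = - integral\<^sup>L (lebesgue_on \<Omega>) (\<lambda>x. (a * g x + b * h x) * \<phi> x)"
      by (auto simp: lin[OF t] distrib_right mult.assoc)
  qed
qed

lemma is_weak_div_zero: "is_weak_div \<Omega> (\<lambda>x. 0) (\<lambda>x. 0)"
proof -
  have "frechet_derivative \<phi> (at x) 0 = 0" if "test_fun \<Omega> \<phi>" for \<phi> and x
  proof -
    have "iter_dderiv [] \<phi> differentiable (at x)"
      using that unfolding test_fun_def smooth_fun_def by blast
    then show ?thesis by (simp add: linear_frechet_derivative linear_0)
  qed
  then show ?thesis by (auto simp: is_weak_div_def)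
qed

section \<open>Inequalities of Young and Hoelder type\<close>

text \<open>The constants are not optimal; this avoids all convexity arguments.\<close>

lemma mult_le_powr_add_powr:
  fixes a b s :: real
  assumes "a \<ge> 0" "b \<ge> 0" "s > 1"
  shows "a * b \<le> a powr s + b powr (s / (s - 1))"
proof -
  \<comment> \<open>The threshold for a at which a^(s-1) = b: below it a b is at most m b = m^s,
    above it at most a a^(s-1).\<close>
  define m where "m = b powr (1 / (s - 1))"
  have m: "m \<ge> 0" "m powr (s - 1) = b" "m powr s = b powr (s / (s - 1))"
    using assms by (auto simp: m_def powr_powr)
  have mult: "x * x powr (s - 1) = x powr s" if "x \<ge> 0" for x :: real
    using that powr_add[of x 1 "s - 1"] by simp
  show ?thesis
  proof (cases "a \<le> m")
    case True
    then have "a * b \<le> m * b" using assms by (intro mult_right_mono) auto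
    also have "\<dots> = b powr (s / (s - 1))" using mult[OF m(1)] m by simp
    finally show ?thesis by (smt (verit) powr_ge_zero)
  next
    case False
    then have "b \<le> a powr (s - 1)" using assms m by (subst m(2)[symmetric]) (intro powr_mono2, auto)
    then have "a * b \<le> a * a powr (s - 1)" using assms by (intro mult_left_mono) auto
    also have "\<dots> = a powr s" using mult assms by simp
    finally show ?thesis by (smt (verit) powr_ge_zero)
  qed
qed

text \<open>Both sides are homogeneous of degree s, so it suffices to bound every factor by the
  largest of the three.\<close>

lemma powr_mult_mult_le_sum_powr:
  fixes a b c s :: real
  assumes "a \<ge> 0" "b \<ge> 0" "c \<ge> 0" "s \<ge> 2"
  shows "a powr (s - 2) * b * c \<le> a powr s + b powr s + c powr s"
proof -
  define m where "m = max a (max b c)"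
  have m: "m \<ge> a" "m \<ge> b" "m \<ge> c" "m \<ge> 0" using assms by (auto simp: m_def)
  have "a powr (s - 2) * b * c \<le> m powr (s - 2) * m * m"
    using assms m by (intro mult_mono powr_mono2) auto
  also have "\<dots> = m powr ((s - 2) + 1 + 1)"
    using m by (simp only: powr_add powr_one)
  also have "\<dots> = m powr s" by simp
  also have "\<dots> \<le> a powr s + b powr s + c powr s"
    using assms by (auto simp: m_def max_def)
  finally show ?thesis .
qed

text \<open>Handles vanishing norms in the Hoelder inequalities below, whose proofs otherwise divide
  by the norms.\<close>

lemma integral_powr_eq_0_imp_AE:
  fixes f :: "'a \<Rightarrow> 'b::real_normed_vector"
  assumes "integrable M (\<lambda>x. norm (f x) powr p)" "(\<integral>x. norm (f x) powr p \<partial>M) = 0"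
  shows "AE x in M. f x = 0"
proof -
  have "AE x in M. norm (f x) powr p = 0"
    using assms by (subst integral_nonneg_eq_0_iff_AE[symmetric]) auto
  then show ?thesis by simp
qed

text \<open>The pointwise product inequality is applied to f / a and g / b, where a and b are the
  two norms. Each normalised power then has integral 1, which yields the constant 2.\<close>

lemma Hoelder_weak:
  fixes f g :: "'a \<Rightarrow> real"
  assumes s: "s > 1" and r: "r = s / (s - 1)"
    and [measurable]: "f \<in> borel_measurable M" "g \<in> borel_measurable M"
    and nn: "\<And>x. f x \<ge> 0" "\<And>x. g x \<ge> 0"
    and f: "integrable M (\<lambda>x. f x powr s)" and g: "integrable M (\<lambda>x. g x powr r)"
  shows "integrable M (\<lambda>x. f x * g x)"
    and "(\<integral>x. f x * g x \<partial>M) \<le> 2 * (\<integral>x. f x powr s \<partial>M) powr (1 / s) * (\<integral>x. g x powr r \<partial>M) powr (1 / r)"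
proof -
  have r1: "r > 0" using s r by simp
  show int: "integrable M (\<lambda>x. f x * g x)"
  proof (rule Bochner_Integration.integrable_bound)
    show "integrable M (\<lambda>x. f x powr s + g x powr r)" using f g by simp
    show "AE x in M. norm (f x * g x) \<le> norm (f x powr s + g x powr r)"
      using mult_le_powr_add_powr[OF nn s] nn r by (auto intro!: AE_I2)
  qed simp
  define A where "A = (\<integral>x. f x powr s \<partial>M)"
  define B where "B = (\<integral>x. g x powr r \<partial>M)"
  have AB: "A \<ge> 0" "B \<ge> 0" by (simp_all add: A_def B_def)
  consider "A = 0" | "B = 0" | "A > 0" "B > 0" using AB by linarith
  then show "(\<integral>x. f x * g x \<partial>M) \<le> 2 * (\<integral>x. f x powr s \<partial>M) powr (1 / s) * (\<integral>x. g x powr r \<partial>M) powr (1 / r)"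
    unfolding A_def[symmetric] B_def[symmetric]
  proof cases
    case 1
    then have "AE x in M. f x = 0"
      using integral_powr_eq_0_imp_AE[of M f s] f nn by (simp add: A_def)
    then have "(\<integral>x. f x * g x \<partial>M) = 0"
      by (intro integral_eq_zero_AE) auto
    with 1 show "(\<integral>x. f x * g x \<partial>M) \<le> 2 * A powr (1 / s) * B powr (1 / r)" by simp
  next
    case 2
    then have "AE x in M. g x = 0"
      using integral_powr_eq_0_imp_AE[of M g r] g nn by (simp add: B_def)
    then have "(\<integral>x. f x * g x \<partial>M) = 0"
      by (intro integral_eq_zero_AE) auto
    with 2 show "(\<integral>x. f x * g x \<partial>M) \<le> 2 * A powr (1 / s) * B powr (1 / r)" by simp
  next
    case 3
    define a b where "a = A powr (1 / s)" and "b = B powr (1 / r)"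
    have ab: "a > 0" "b > 0" "a powr s = A" "b powr r = B"
      using 3 s r1 by (auto simp: a_def b_def powr_powr)
    have "f x * g x \<le> a * b * (f x powr s / A + g x powr r / B)" for x
    proof -
      have "(f x / a) * (g x / b) \<le> (f x / a) powr s + (g x / b) powr r"
        using mult_le_powr_add_powr[of "f x / a" "g x / b" s] nn ab s r by simp
      also have "\<dots> = f x powr s / A + g x powr r / B"
        using ab nn by (simp add: powr_divide)
      finally show ?thesis using ab by (simp add: field_simps)
    qed
    then have "(\<integral>x. f x * g x \<partial>M) \<le> (\<integral>x. a * b * (f x powr s / A + g x powr r / B) \<partial>M)"
      using int f g by (intro integral_mono) auto
    also have "\<dots> = a * b * (A / A + B / B)" using f g by (simp add: A_def B_def)
    also have "\<dots> = 2 * A powr (1 / s) * B powr (1 / r)"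
      using 3 by (simp add: a_def b_def)
    finally show "(\<integral>x. f x * g x \<partial>M) \<le> 2 * A powr (1 / s) * B powr (1 / r)" .
  qed
qed

text \<open>The same normalisation for the exponents s / (s - 2), s, s; three integrals equal to 1
  yield the constant 3. The shape is that of the growth condition on F paired with a test
  function.\<close>

lemma Hoelder_weak_three:
  fixes f g h :: "'a \<Rightarrow> real"
  assumes s: "s > 2"
    and [measurable]: "f \<in> borel_measurable M" "g \<in> borel_measurable M" "h \<in> borel_measurable M"
    and nn: "\<And>x. f x \<ge> 0" "\<And>x. g x \<ge> 0" "\<And>x. h x \<ge> 0"
    and f: "integrable M (\<lambda>x. f x powr s)" and g: "integrable M (\<lambda>x. g x powr s)"
    and h: "integrable M (\<lambda>x. h x powr s)"
  shows "integrable M (\<lambda>x. f x powr (s - 2) * g x * h x)"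
    and "(\<integral>x. f x powr (s - 2) * g x * h x \<partial>M) \<le> 3 * ((\<integral>x. f x powr s \<partial>M) powr (1 / s)) powr (s - 2)
           * (\<integral>x. g x powr s \<partial>M) powr (1 / s) * (\<integral>x. h x powr s \<partial>M) powr (1 / s)"
proof -
  show int: "integrable M (\<lambda>x. f x powr (s - 2) * g x * h x)"
  proof (rule Bochner_Integration.integrable_bound)
    show "integrable M (\<lambda>x. f x powr s + g x powr s + h x powr s)" using f g h by simp
    show "AE x in M. norm (f x powr (s - 2) * g x * h x) \<le> norm (f x powr s + g x powr s + h x powr s)"
      using powr_mult_mult_le_sum_powr[OF nn] nn s by (auto intro!: AE_I2)
  qed simp
  define A where "A = (\<integral>x. f x powr s \<partial>M)"
  define B where "B = (\<integral>x. g x powr s \<partial>M)"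
  define C where "C = (\<integral>x. h x powr s \<partial>M)"
  have AB: "A \<ge> 0" "B \<ge> 0" "C \<ge> 0" by (simp_all add: A_def B_def C_def)
  have zero: "AE x in M. k x = 0" if "integrable M (\<lambda>x. k x powr s)" "(\<integral>x. k x powr s \<partial>M) = 0" "\<And>x. k x \<ge> 0"
    for k :: "'a \<Rightarrow> real"
    using that integral_powr_eq_0_imp_AE[of M k s] by simp
  consider "A = 0" | "B = 0" | "C = 0" | "A > 0" "B > 0" "C > 0" using AB by linarith
  then show "(\<integral>x. f x powr (s - 2) * g x * h x \<partial>M) \<le> 3 * ((\<integral>x. f x powr s \<partial>M) powr (1 / s)) powr (s - 2)
           * (\<integral>x. g x powr s \<partial>M) powr (1 / s) * (\<integral>x. h x powr s \<partial>M) powr (1 / s)"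
    unfolding A_def[symmetric] B_def[symmetric] C_def[symmetric]
  proof cases
    case 1
    then have "AE x in M. f x = 0" using zero f nn by (simp add: A_def)
    then have "(\<integral>x. f x powr (s - 2) * g x * h x \<partial>M) = 0"
      by (intro integral_eq_zero_AE) auto
    then show "(\<integral>x. f x powr (s - 2) * g x * h x \<partial>M) \<le> 3 * (A powr (1 / s)) powr (s - 2) * B powr (1 / s) * C powr (1 / s)"
      by simp
  next
    case 2
    then have "AE x in M. g x = 0" using zero g nn by (simp add: B_def)
    then have "(\<integral>x. f x powr (s - 2) * g x * h x \<partial>M) = 0"
      by (intro integral_eq_zero_AE) auto
    then show "(\<integral>x. f x powr (s - 2) * g x * h x \<partial>M) \<le> 3 * (A powr (1 / s)) powr (s - 2) * B powr (1 / s) * C powr (1 / s)"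
      by simp
  next
    case 3
    then have "AE x in M. h x = 0" using zero h nn by (simp add: C_def)
    then have "(\<integral>x. f x powr (s - 2) * g x * h x \<partial>M) = 0"
      by (intro integral_eq_zero_AE) auto
    then show "(\<integral>x. f x powr (s - 2) * g x * h x \<partial>M) \<le> 3 * (A powr (1 / s)) powr (s - 2) * B powr (1 / s) * C powr (1 / s)"
      by simp
  next
    case 4
    define a b c where "a = A powr (1 / s)" and "b = B powr (1 / s)" and "c = C powr (1 / s)"
    have ab: "a > 0" "b > 0" "c > 0" "a powr s = A" "b powr s = B" "c powr s = C"
      using 4 s by (auto simp: a_def b_def c_def powr_powr)
    have "f x powr (s - 2) * g x * h x \<le> a powr (s - 2) * b * c * (f x powr s / A + g x powr s / B + h x powr s / C)" for x
    proof -
      have "(f x / a) powr (s - 2) * (g x / b) * (h x / c) \<le> (f x / a) powr s + (g x / b) powr s + (h x / c) powr s"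
        using powr_mult_mult_le_sum_powr[of "f x / a" "g x / b" "h x / c" s] nn ab s by simp
      also have "\<dots> = f x powr s / A + g x powr s / B + h x powr s / C"
        using ab nn by (simp add: powr_divide)
      finally have "f x powr (s - 2) / a powr (s - 2) * (g x / b) * (h x / c) \<le> f x powr s / A + g x powr s / B + h x powr s / C"
        using ab nn by (simp add: powr_divide)
      then have "a powr (s - 2) * b * c * (f x powr (s - 2) / a powr (s - 2) * (g x / b) * (h x / c))
          \<le> a powr (s - 2) * b * c * (f x powr s / A + g x powr s / B + h x powr s / C)"
        using ab by (intro mult_left_mono) auto
      then show ?thesis using ab by simp
    qed
    then have "(\<integral>x. f x powr (s - 2) * g x * h x \<partial>M)
        \<le> (\<integral>x. a powr (s - 2) * b * c * (f x powr s / A + g x powr s / B + h x powr s / C) \<partial>M)"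
      using int f g h by (intro integral_mono) auto
    also have "\<dots> = a powr (s - 2) * b * c * (A / A + B / B + C / C)" using f g h by (simp add: A_def B_def C_def)
    also have "\<dots> = 3 * a powr (s - 2) * b * c"
      using 4 by simp
    finally show "(\<integral>x. f x powr (s - 2) * g x * h x \<partial>M) \<le> 3 * (A powr (1 / s)) powr (s - 2) * B powr (1 / s) * C powr (1 / s)"
      by (simp add: a_def b_def c_def)
  qed
qed

section \<open>A bounded right inverse of the divergence\<close>

lemma
  fixes f :: "'a::euclidean_space \<Rightarrow> real"
  assumes [measurable]: "f \<in> borel_measurable borel"
  shows integrable_lborel_translation: "integrable lborel (\<lambda>x. f (x + c)) \<longleftrightarrow> integrable lborel f"
    and integral_lborel_translation: "(\<integral>x. f (x + c) \<partial>lborel) = (\<integral>x. f x \<partial>lborel)"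
proof -
  have "integrable (distr lborel borel ((+) c)) f \<longleftrightarrow> integrable lborel (\<lambda>x. f (c + x))"
    by (rule integrable_distr_eq) auto
  then show "integrable lborel (\<lambda>x. f (x + c)) \<longleftrightarrow> integrable lborel f"
    by (simp add: lborel_distr_plus add.commute)
  have "integral\<^sup>L (distr lborel borel ((+) c)) f = (\<integral>x. f (c + x) \<partial>lborel)"
    by (rule integral_distr) auto
  then show "(\<integral>x. f (x + c) \<partial>lborel) = (\<integral>x. f x \<partial>lborel)"
    by (simp add: lborel_distr_plus add.commute)
qed

text \<open>By translation invariance the integral over x does not depend on t, so after Fubini only
  the length R of the parameter interval remains.\<close>

lemma
  fixes f :: "'a::euclidean_space \<Rightarrow> real"
  assumes f: "integrable lborel f" and R: "R \<ge> 0"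
  shows integrable_shift_family:
      "integrable (lborel \<Otimes>\<^sub>M lborel) (\<lambda>(t::real, x). indicator {0..R} t * f (x - t *\<^sub>R e))"
    and integral_shift_family:
      "(\<integral>x. (\<integral>t. indicator {0..R} t * f (x - t *\<^sub>R e) \<partial>lborel) \<partial>lborel) = R * (\<integral>x. f x \<partial>lborel)"
proof -
  have [measurable]: "f \<in> borel_measurable borel" using f by auto
  have tr: "(\<integral>x. h (x - t *\<^sub>R e) \<partial>lborel) = (\<integral>x. h x \<partial>lborel)" if "h \<in> borel_measurable borel"
    for h :: "'a \<Rightarrow> real" and t :: real
    using integral_lborel_translation[OF that, of "- (t *\<^sub>R e)"] by simp
  have tri: "integrable lborel (\<lambda>x. f (x - t *\<^sub>R e))" for t :: real
    using integrable_lborel_translation[of f "- (t *\<^sub>R e)"] f by simp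
  have R_int: "integrable lborel (indicator {0..R} :: real \<Rightarrow> real)" using R by simp
  show int: "integrable (lborel \<Otimes>\<^sub>M lborel) (\<lambda>(t::real, x). indicator {0..R} t * f (x - t *\<^sub>R e))"
  proof (rule lborel_pair.Fubini_integrable)
    have "(\<integral>x. \<bar>f (x - t *\<^sub>R e)\<bar> \<partial>lborel) = (\<integral>x. \<bar>f x\<bar> \<partial>lborel)" for t :: real
      by (rule tr) auto
    then show "integrable lborel (\<lambda>t::real. \<integral>x. norm (case (t, x) of (t, x) \<Rightarrow> indicator {0..R} t * f (x - t *\<^sub>R e)) \<partial>lborel)"
      using R_int by (simp add: abs_mult)
    show "AE t::real in lborel. integrable lborel (\<lambda>x. case (t, x) of (t, x) \<Rightarrow> indicator {0..R} t * f (x - t *\<^sub>R e))"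
      using tri by auto
  qed measurable
  have "(\<integral>x. (\<integral>t. indicator {0..R} t * f (x - t *\<^sub>R e) \<partial>lborel) \<partial>lborel)
      = (\<integral>t. (\<integral>x. indicator {0..R} t * f (x - t *\<^sub>R e) \<partial>lborel) \<partial>lborel)"
    by (rule lborel_pair.Fubini_integral[OF int])
  also have "\<dots> = (\<integral>t. indicator {0..R} t * (\<integral>x. f x \<partial>lborel) \<partial>lborel)"
    by (simp add: tr)
  also have "\<dots> = R * (\<integral>x. f x \<partial>lborel)"
    using R by simp
  finally show "(\<integral>x. (\<integral>t. indicator {0..R} t * f (x - t *\<^sub>R e) \<partial>lborel) \<partial>lborel) = R * (\<integral>x. f x \<partial>lborel)" .
qed

text \<open>Swapping the order of the product makes t the inner variable in Fubini's
  theorem.\<close>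

lemma
  fixes f :: "'a::euclidean_space \<Rightarrow> real"
  assumes f: "integrable lborel f" and R: "R \<ge> 0"
  shows shift_integral_integrable: "integrable lborel (\<lambda>x. \<integral>t. indicator {0..R} t * f (x - t *\<^sub>R e) \<partial>lborel)"
    and AE_shift_integrable: "AE x in lborel. integrable lborel (\<lambda>t::real. indicator {0..R} t * f (x - t *\<^sub>R e))"
proof -
  have "integrable (lborel \<Otimes>\<^sub>M lborel) (\<lambda>(x, t::real). indicator {0..R} t * f (x - t *\<^sub>R e))"
    using integrable_shift_family[OF f R, of e]
    by (subst lborel_pair.integrable_product_swap_iff[symmetric]) (simp add: case_prod_beta)
  from lborel_pair.integrable_fst'[OF this] lborel_pair.AE_integrable_fst'[OF this]
  show "integrable lborel (\<lambda>x. \<integral>t. indicator {0..R} t * f (x - t *\<^sub>R e) \<partial>lborel)"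
    "AE x in lborel. integrable lborel (\<lambda>t::real. indicator {0..R} t * f (x - t *\<^sub>R e))"
    by (simp_all only: prod.case)
qed

section \<open>Test functions and their directional derivatives\<close>

lemma test_fun_has_derivative:
  assumes "test_fun \<Omega> \<phi>"
  shows "(\<phi> has_derivative frechet_derivative \<phi> (at x)) (at x)"
proof -
  have "iter_dderiv [] \<phi> differentiable (at x)"
    using assms unfolding test_fun_def smooth_fun_def by blast
  then show ?thesis by (simp add: frechet_derivative_works)
qed

lemma test_fun_continuous: "test_fun \<Omega> \<phi> \<Longrightarrow> continuous_on A \<phi>"
  by (meson test_fun_has_derivative has_derivative_continuous continuous_at_imp_continuous_on)

text \<open>With the list \<open>[e]\<close>, smoothness says that this directional derivative is
  differentiable, hence continuous.\<close>

lemma test_fun_deriv_continuous: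
  assumes "test_fun \<Omega> \<phi>"
  shows "continuous_on A (\<lambda>x. frechet_derivative \<phi> (at x) e)"
proof -
  have "iter_dderiv [e] \<phi> differentiable (at x)" for x
    using assms unfolding test_fun_def smooth_fun_def by blast
  then show ?thesis
    by (auto intro!: continuous_at_imp_continuous_on differentiable_imp_continuous_within)
qed

lemma test_fun_outside: "test_fun \<Omega> \<phi> \<Longrightarrow> x \<notin> \<Omega> \<Longrightarrow> \<phi> x = 0"
  unfolding test_fun_def using closure_subset[of "{x. \<phi> x \<noteq> 0}"] by blast

lemma test_fun_deriv_outside_support:
  assumes "test_fun \<Omega> \<phi>" "x \<notin> closure {x. \<phi> x \<noteq> 0}"
  shows "frechet_derivative \<phi> (at x) e = 0"
proof -
  have "((\<lambda>x. 0) has_derivative (\<lambda>x. 0)) (at x)" by simp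
  then have "(\<phi> has_derivative (\<lambda>x. 0)) (at x)"
    by (rule has_derivative_transform_within_open[where s="- closure {x. \<phi> x \<noteq> 0}"])
       (use assms(2) closure_subset[of "{x. \<phi> x \<noteq> 0}"] in auto)
  then have "frechet_derivative \<phi> (at x) = (\<lambda>x. 0)"
    by (metis frechet_derivative_at)
  then show ?thesis by simp
qed

lemma test_fun_deriv_outside:
  "test_fun \<Omega> \<phi> \<Longrightarrow> x \<notin> \<Omega> \<Longrightarrow> frechet_derivative \<phi> (at x) e = 0"
  by (rule test_fun_deriv_outside_support) (auto simp: test_fun_def)

lemma bounded_of_compact_support:
  fixes f :: "'a::topological_space \<Rightarrow> real"
  assumes "compact K" "continuous_on K f" "\<And>x. x \<notin> K \<Longrightarrow> f x = 0"
  obtains B where "B \<ge> 0" "\<And>x. \<bar>f x\<bar> \<le> B"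
proof -
  obtain B where "B > 0" "\<And>x. x \<in> K \<Longrightarrow> norm (f x) \<le> B"
    using compact_imp_bounded[OF compact_continuous_image[OF assms(2,1)]]
    by (auto simp: bounded_pos)
  moreover from this assms(3) have "\<bar>f x\<bar> \<le> B" for x
    by (cases "x \<in> K") auto
  ultimately show ?thesis by (intro that[of B]) auto
qed

lemma test_fun_bounded:
  assumes "test_fun \<Omega> \<phi>"
  obtains B where "B \<ge> 0" "\<And>x. \<bar>\<phi> x\<bar> \<le> B"
proof (rule bounded_of_compact_support[of "closure {x. \<phi> x \<noteq> 0}" \<phi>])
  show "compact (closure {x. \<phi> x \<noteq> 0})" using assms by (simp add: test_fun_def)
  show "\<phi> x = 0" if "x \<notin> closure {x. \<phi> x \<noteq> 0}" for x
    using that closure_subset[of "{x. \<phi> x \<noteq> 0}"] by blast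
qed (use test_fun_continuous[OF assms] that in blast)+

lemma test_fun_deriv_bounded:
  assumes "test_fun \<Omega> \<phi>"
  obtains B where "B \<ge> 0" "\<And>x. \<bar>frechet_derivative \<phi> (at x) e\<bar> \<le> B"
proof (rule bounded_of_compact_support[of "closure {x. \<phi> x \<noteq> 0}" "\<lambda>x. frechet_derivative \<phi> (at x) e"])
  show "compact (closure {x. \<phi> x \<noteq> 0})" using assms by (simp add: test_fun_def)
qed (use test_fun_deriv_continuous[OF assms] test_fun_deriv_outside_support[OF assms] that in blast)+

text \<open>Fubini and a translation move the shift from f to the derivative of \<phi>; along each
  line in direction e the fundamental theorem of calculus then leaves the two end points. This is
  the weak form of the statement that the line integral has derivative f x - f (x - R e) in
  direction e.\<close>

lemma integral_deriv_shift:
  fixes \<phi> :: "('n::finite) sfun" and f :: "('n::finite) sfun"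
  assumes \<phi>: "test_fun \<Omega> \<phi>" and f: "integrable lborel f" and R: "R \<ge> 0"
  shows "(\<integral>x. frechet_derivative \<phi> (at x) e * (\<integral>t. indicator {0..R} t * f (x - t *\<^sub>R e) \<partial>lborel) \<partial>lborel)
       = (\<integral>y. f y * (\<phi> (y + R *\<^sub>R e) - \<phi> y) \<partial>lborel)"
proof -
  define d where "d = (\<lambda>x. frechet_derivative \<phi> (at x) e)"
  obtain B where B: "B \<ge> 0" "\<And>x. \<bar>d x\<bar> \<le> B"
    using test_fun_deriv_bounded[OF \<phi>, of e] unfolding d_def by blast
  have [measurable]: "d \<in> borel_measurable borel" "f \<in> borel_measurable borel"
    using test_fun_deriv_continuous[OF \<phi>, of UNIV e] f
    by (auto simp: d_def intro: borel_measurable_continuous_onI)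
  have int1: "integrable (lborel \<Otimes>\<^sub>M lborel) (\<lambda>(t::real, x). d x * (indicator {0..R} t * f (x - t *\<^sub>R e)))"
  proof (rule Bochner_Integration.integrable_bound)
    show "integrable (lborel \<Otimes>\<^sub>M lborel) (\<lambda>z. B * (case z of (t::real, x) \<Rightarrow> indicator {0..R} t * f (x - t *\<^sub>R e)))"
      by (intro integrable_mult_right integrable_shift_family f R)
    show "AE z in lborel \<Otimes>\<^sub>M lborel. norm (case z of (t::real, x) \<Rightarrow> d x * (indicator {0..R} t * f (x - t *\<^sub>R e)))
        \<le> norm (B * (case z of (t::real, x) \<Rightarrow> indicator {0..R} t * f (x - t *\<^sub>R e)))"
      using B by (intro AE_I2) (auto simp: abs_mult split: prod.splits intro!: mult_right_mono)
  qed measurable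
  have int2: "integrable (lborel \<Otimes>\<^sub>M lborel) (\<lambda>(t::real, y). indicator {0..R} t * (d (y + t *\<^sub>R e) * f y))"
  proof (rule Bochner_Integration.integrable_bound)
    \<comment> \<open>The shift family in direction 0 is the indicator times f, which serves as an
      integrable majorant.\<close>
    show "integrable (lborel \<Otimes>\<^sub>M lborel) (\<lambda>z. B * (case z of (t::real, x) \<Rightarrow> indicator {0..R} t * f (x - t *\<^sub>R 0)))"
      by (intro integrable_mult_right integrable_shift_family f R)
    show "AE z in lborel \<Otimes>\<^sub>M lborel. norm (case z of (t::real, y) \<Rightarrow> indicator {0..R} t * (d (y + t *\<^sub>R e) * f y))
        \<le> norm (B * (case z of (t::real, x) \<Rightarrow> indicator {0..R} t * f (x - t *\<^sub>R 0)))"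
      using B by (intro AE_I2) (auto simp: abs_mult split: prod.splits split_indicator intro!: mult_right_mono)
  qed measurable
  have "(\<integral>x. d x * (\<integral>t. indicator {0..R} t * f (x - t *\<^sub>R e) \<partial>lborel) \<partial>lborel)
      = (\<integral>x. (\<integral>t. d x * (indicator {0..R} t * f (x - t *\<^sub>R e)) \<partial>lborel) \<partial>lborel)"
    by (simp only: integral_mult_right_zero)
  also have "\<dots> = (\<integral>t. (\<integral>x. d x * (indicator {0..R} t * f (x - t *\<^sub>R e)) \<partial>lborel) \<partial>lborel)"
    by (rule lborel_pair.Fubini_integral[OF int1])
  also have "\<dots> = (\<integral>t. (\<integral>y. indicator {0..R} t * (d (y + t *\<^sub>R e) * f y) \<partial>lborel) \<partial>lborel)"
  proof (rule Bochner_Integration.integral_cong[OF refl])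
    fix t :: real
    have "(\<integral>x. d x * (indicator {0..R} t * f (x - t *\<^sub>R e)) \<partial>lborel)
       = (\<integral>y. d (y + t *\<^sub>R e) * (indicator {0..R} t * f (y + t *\<^sub>R e - t *\<^sub>R e)) \<partial>lborel)"
      by (rule integral_lborel_translation[symmetric]) measurable
    then show "(\<integral>x. d x * (indicator {0..R} t * f (x - t *\<^sub>R e)) \<partial>lborel)
       = (\<integral>y. indicator {0..R} t * (d (y + t *\<^sub>R e) * f y) \<partial>lborel)"
      by (simp add: mult_ac)
  qed
  also have "\<dots> = (\<integral>y. (\<integral>t. indicator {0..R} t * (d (y + t *\<^sub>R e) * f y) \<partial>lborel) \<partial>lborel)"
    by (rule lborel_pair.Fubini_integral[OF int2, symmetric])
  also have "\<dots> = (\<integral>y. f y * (\<phi> (y + R *\<^sub>R e) - \<phi> y) \<partial>lborel)"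
  proof (rule Bochner_Integration.integral_cong[OF refl])
    fix y
    have "(\<integral>t. d (y + t *\<^sub>R e) * indicator {0..R} t \<partial>lborel) = \<phi> (y + R *\<^sub>R e) - \<phi> (y + 0 *\<^sub>R e)"
    proof (rule integral_FTC_Icc_real[OF R])
      fix t :: real
      have "((\<lambda>t. y + t *\<^sub>R e) has_derivative (\<lambda>h. h *\<^sub>R e)) (at t)"
        by (auto intro!: derivative_eq_intros)
      from has_derivative_compose[OF this test_fun_has_derivative[OF \<phi>]]
      have "((\<lambda>t. \<phi> (y + t *\<^sub>R e)) has_derivative (\<lambda>h. frechet_derivative \<phi> (at (y + t *\<^sub>R e)) (h *\<^sub>R e))) (at t)" .
      moreover have "linear (frechet_derivative \<phi> (at (y + t *\<^sub>R e)))"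
        using test_fun_has_derivative[OF \<phi>] has_derivative_linear by blast
      ultimately show "((\<lambda>t. \<phi> (y + t *\<^sub>R e)) has_real_derivative d (y + t *\<^sub>R e)) (at t)"
        by (simp add: has_field_derivative_def d_def linear_scale mult.commute[of _ "frechet_derivative \<phi> _ _"])
      have "continuous_on UNIV (\<lambda>t. d (y + t *\<^sub>R e))"
        unfolding d_def
        by (rule continuous_on_compose2[OF test_fun_deriv_continuous[OF \<phi>, of UNIV]])
           (auto intro!: continuous_intros)
      then show "isCont (\<lambda>t. d (y + t *\<^sub>R e)) t"
        by (simp add: continuous_on_eq_continuous_at)
    qed
    then have "f y * (\<integral>t. d (y + t *\<^sub>R e) * indicator {0..R} t \<partial>lborel) = f y * (\<phi> (y + R *\<^sub>R e) - \<phi> y)"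
      by simp
    then show "(\<integral>t. indicator {0..R} t * (d (y + t *\<^sub>R e) * f y) \<partial>lborel) = f y * (\<phi> (y + R *\<^sub>R e) - \<phi> y)"
      by (subst (asm) integral_mult_right_zero[symmetric]) (simp add: mult_ac)
  qed
  finally show ?thesis unfolding d_def .
qed

text \<open>The function spaces use Lebesgue measure on \<Omega>, whereas translation and Fubini are
  used for Borel functions on the whole space. This passes between f and a Borel representative h of
  its extension by zero.\<close>

lemma
  fixes f h :: "'a::euclidean_space \<Rightarrow> real"
  assumes \<Omega>: "\<Omega> \<in> sets lebesgue" and f: "f \<in> borel_measurable (lebesgue_on \<Omega>)"
    and h: "h \<in> borel_measurable borel" and eq: "AE x in lborel. indicator \<Omega> x * f x = h x"
  shows integrable_lebesgue_on_iff_lborel: "integrable (lebesgue_on \<Omega>) f \<longleftrightarrow> integrable lborel h"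
    and integral_lebesgue_on_eq_lborel: "integral\<^sup>L (lebesgue_on \<Omega>) f = integral\<^sup>L lborel h"
proof -
  have h': "h \<in> borel_measurable lborel" using h by simp
  have f': "(\<lambda>x. indicator \<Omega> x * f x) \<in> borel_measurable lebesgue"
    using f \<Omega> borel_measurable_restrict_space_iff[of \<Omega> lebesgue f] by simp
  have eq': "AE x in lebesgue. indicator \<Omega> x * f x = h x" using eq by (rule AE_completion)
  have hl: "h \<in> borel_measurable lebesgue" using h' by (rule measurable_completion)
  show "integrable (lebesgue_on \<Omega>) f \<longleftrightarrow> integrable lborel h"
    using integrable_cong_AE[OF f' hl eq'] integrable_completion[OF h'] \<Omega>
    by (simp add: integrable_restrict_space)
  show "integral\<^sup>L (lebesgue_on \<Omega>) f = integral\<^sup>L lborel h"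
    using integral_cong_AE[OF f' hl eq'] integral_completion[OF h'] \<Omega>
    by (simp add: integral_restrict_space)
qed

lemma abs_le_one_plus_powr:
  fixes a s :: real
  assumes "s \<ge> 1"
  shows "\<bar>a\<bar> \<le> 1 + \<bar>a\<bar> powr s"
proof (cases "\<bar>a\<bar> \<le> 1")
  case False
  then have "\<bar>a\<bar> powr 1 \<le> \<bar>a\<bar> powr s" using assms by (intro powr_mono) auto
  with False show ?thesis by simp
qed (smt (verit) powr_ge_zero)

text \<open>Hoelder in t against the indicator of the segment bounds |V x|^s by the line integral of
  |f|^s, up to the constant 2 R^(1-1/s) to the power s. Integrating over x gives one more factor
  R.\<close>

lemma
  fixes f :: "'a::euclidean_space \<Rightarrow> real" and e :: 'a
  assumes s: "s > 1" and R: "R > 0" and f: "integrable lborel f"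
    and fs: "integrable lborel (\<lambda>x. \<bar>f x\<bar> powr s)"
  defines "V \<equiv> \<lambda>x. \<integral>t. indicator {0..R} t * f (x - t *\<^sub>R e) \<partial>lborel"
  shows shift_integral_powr_integrable: "integrable lborel (\<lambda>x. \<bar>V x\<bar> powr s)"
    and shift_integral_powr_bound:
      "(\<integral>x. \<bar>V x\<bar> powr s \<partial>lborel) \<le> (2 * R powr (1 - 1 / s)) powr s * R * (\<integral>x. \<bar>f x\<bar> powr s \<partial>lborel)"
proof -
  define r where "r = s / (s - 1)"
  define C where "C = 2 * R powr (1 - 1 / s)"
  have "C > 0" using R by (simp add: C_def)
  have r: "r > 1" "1 / r = 1 - 1 / s" using s by (auto simp: r_def field_simps)
  have [measurable]: "f \<in> borel_measurable borel" using f by auto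
  let ?W = "\<lambda>x. \<integral>t. indicator {0..R} t * \<bar>f (x - t *\<^sub>R e)\<bar> powr s \<partial>lborel"
  have "integrable lborel V"
    unfolding V_def using f R by (intro shift_integral_integrable) auto
  then have [measurable]: "V \<in> borel_measurable borel" by auto
  have W: "integrable lborel ?W"
    using shift_integral_integrable[OF fs] R by auto
  have bound: "AE x in lborel. \<bar>V x\<bar> powr s \<le> C powr s * ?W x"
    using AE_shift_integrable[OF f less_imp_le[OF R], of e] AE_shift_integrable[OF fs less_imp_le[OF R], of e]
  proof eventually_elim
    case (elim x)
    let ?h = "\<lambda>t::real. indicator {0..R} t * \<bar>f (x - t *\<^sub>R e)\<bar>"
    have h_powr: "(\<lambda>t. ?h t powr s) = (\<lambda>t::real. indicator {0..R} t * \<bar>f (x - t *\<^sub>R e)\<bar> powr s)"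
      by (auto simp: indicator_def)
    have i_powr: "(\<lambda>t::real. indicator {0..R} t powr r) = (indicator {0..R} :: real \<Rightarrow> real)"
      by (auto simp: indicator_def)
    have "\<bar>V x\<bar> \<le> (\<integral>t. \<bar>indicator {0..R} t * f (x - t *\<^sub>R e)\<bar> \<partial>lborel)"
      unfolding V_def by (rule integral_abs_bound)
    \<comment> \<open>The indicator equals its square; the second copy becomes the other Hoelder
      factor, with norm R^(1/r) = R^(1-1/s).\<close>
    also have "\<dots> = (\<integral>t. ?h t * indicator {0..R} t \<partial>lborel)"
      by (intro Bochner_Integration.integral_cong) (auto simp: indicator_def)
    also have "\<dots> \<le> 2 * (\<integral>t. ?h t powr s \<partial>lborel) powr (1 / s)
        * (\<integral>t. (indicator {0..R} t :: real) powr r \<partial>lborel) powr (1 / r)"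
      by (rule Hoelder_weak[OF s r_def]) (use elim R in \<open>auto simp: h_powr i_powr\<close>)
    also have "\<dots> = C * ?W x powr (1 / s)"
      using R r by (simp add: h_powr i_powr C_def)
    finally have "\<bar>V x\<bar> powr s \<le> (C * ?W x powr (1 / s)) powr s"
      using s by (intro powr_mono2) auto
    also have "\<dots> = C powr s * ?W x"
      using \<open>C > 0\<close> s by (simp add: powr_mult powr_powr)
    finally show ?case .
  qed
  show int: "integrable lborel (\<lambda>x. \<bar>V x\<bar> powr s)"
  proof (rule Bochner_Integration.integrable_bound)
    show "integrable lborel (\<lambda>x. C powr s * ?W x)" using W by simp
    show "AE x in lborel. norm (\<bar>V x\<bar> powr s) \<le> norm (C powr s * ?W x)"
      using bound by eventually_elim auto
  qed simp
  have "(\<integral>x. \<bar>V x\<bar> powr s \<partial>lborel) \<le> (\<integral>x. C powr s * ?W x \<partial>lborel)"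
    using int W bound by (intro integral_mono_AE) auto
  also have "\<dots> = C powr s * (R * (\<integral>x. \<bar>f x\<bar> powr s \<partial>lborel))"
    using integral_shift_family[OF fs less_imp_le[OF R], of e] by simp
  finally show "(\<integral>x. \<bar>V x\<bar> powr s \<partial>lborel) \<le> (2 * R powr (1 - 1 / s)) powr s * R * (\<integral>x. \<bar>f x\<bar> powr s \<partial>lborel)"
    by (simp add: C_def mult.assoc)
qed

text \<open>For v = V e the divergence is the derivative of V along e, that is f x - f (x - R e),
  and the second term vanishes on \<Omega>. So simple a choice is possible because the space V
  prescribes no boundary values.\<close>

lemma weak_div_right_inverse:
  fixes \<Omega> :: "(real^'n::finite) set"
  assumes \<Omega>: "open \<Omega>" "bounded \<Omega>" and s: "s > 1"
  obtains K where "K \<ge> 0" "\<And>g. in_Lp s \<Omega> g \<Longrightarrow>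
     \<exists>v. in_Lp s \<Omega> v \<and> is_weak_div \<Omega> v g \<and> Lp_norm s \<Omega> v \<le> K * Lp_norm s \<Omega> g"
proof -
  obtain e :: "real^'n" where e: "norm e = 1"
    using vector_choose_size[of 1] by auto
  obtain \<rho> where \<rho>: "\<rho> > 0" "\<Omega> \<subseteq> ball 0 \<rho>"
    using bounded_subset_ballD[OF \<Omega>(2), of 0] by auto
  \<comment> \<open>Two points of \<Omega> have distance less than 2 \<rho>, so a shift by R e
    leaves \<Omega>.\<close>
  define R where "R = 2 * \<rho>"
  have R: "R > 0" using \<rho> by (simp add: R_def)
  have out: "y + R *\<^sub>R e \<notin> \<Omega>" if "y \<in> \<Omega>" for y
  proof
    assume "y + R *\<^sub>R e \<in> \<Omega>"
    with that \<rho> have "norm (y + R *\<^sub>R e) < \<rho>" "norm y < \<rho>" by auto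
    then have "norm (R *\<^sub>R e) < 2 * \<rho>"
      using norm_triangle_ineq4[of "y + R *\<^sub>R e" y] by simp
    with e \<rho> show False by (simp add: R_def)
  qed
  define C where "C = (2 * R powr (1 - 1 / s)) powr s * R"
  have C: "C \<ge> 0" using R by (simp add: C_def)
  have \<Omega>m [measurable]: "\<Omega> \<in> sets lebesgue" "\<Omega> \<in> sets borel" using \<Omega> by auto
  have \<Omega>fin: "integrable lborel (indicator \<Omega> :: _ \<Rightarrow> real)"
    using \<Omega>(2) emeasure_bounded_finite[of \<Omega>] by (intro integrable_real_indicator) auto
  have "\<exists>v. in_Lp s \<Omega> v \<and> is_weak_div \<Omega> v g \<and> Lp_norm s \<Omega> v \<le> C powr (1 / s) * Lp_norm s \<Omega> g"
    if g: "in_Lp s \<Omega> g" for g :: "(real^'n) \<Rightarrow> real"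
  proof -
    have gm: "g \<in> borel_measurable (lebesgue_on \<Omega>)" using g by (simp add: in_Lp_def)
    then have "(\<lambda>x. indicator \<Omega> x * g x) \<in> borel_measurable lebesgue"
      using borel_measurable_restrict_space_iff[of \<Omega> lebesgue g] by simp
    \<comment> \<open>A Borel representative of the zero extension of g; it vanishes only almost
      everywhere outside \<Omega>.\<close>
    then obtain f where [measurable]: "f \<in> borel_measurable borel" and
      f_eq: "AE x in lborel. indicator \<Omega> x * g x = f x"
      using completion_ex_borel_measurable_real[of _ lborel] by auto
    have powr_eq: "AE x in lborel. indicator \<Omega> x * norm (g x) powr s = \<bar>f x\<bar> powr s"
      using f_eq
    proof eventually_elim
      case (elim x)
      then show ?case by (cases "x \<in> \<Omega>") (auto simp: indicator_def)
    qed
    have gpm: "(\<lambda>x. norm (g x) powr s) \<in> borel_measurable (lebesgue_on \<Omega>)"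
      using gm by measurable
    have fs: "integrable lborel (\<lambda>x. \<bar>f x\<bar> powr s)"
      using integrable_lebesgue_on_iff_lborel[OF \<Omega>m(1) gpm _ powr_eq] g by (simp add: in_Lp_def)
    have fs_eq: "(\<integral>x. \<bar>f x\<bar> powr s \<partial>lborel) = integral\<^sup>L (lebesgue_on \<Omega>) (\<lambda>x. norm (g x) powr s)"
      using integral_lebesgue_on_eq_lborel[OF \<Omega>m(1) gpm _ powr_eq] by simp
    \<comment> \<open>As \<Omega> is bounded, L^s is contained in L^1: off a null set |f| is at most
      1 + |f|^s on \<Omega> and 0 elsewhere.\<close>
    have f: "integrable lborel f"
    proof (rule Bochner_Integration.integrable_bound)
      show "integrable lborel (\<lambda>x. indicator \<Omega> x + \<bar>f x\<bar> powr s)" using \<Omega>fin fs by simp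
      show "AE x in lborel. norm (f x) \<le> norm (indicator \<Omega> x + \<bar>f x\<bar> powr s)"
        using f_eq
      proof eventually_elim
        case (elim x)
        then show ?case
          using abs_le_one_plus_powr[of s "f x"] s by (cases "x \<in> \<Omega>") auto
      qed
    qed simp
    define V where "V = (\<lambda>x. \<integral>t. indicator {0..R} t * f (x - t *\<^sub>R e) \<partial>lborel)"
    define v where "v x = V x *\<^sub>R e" for x
    have V_int: "integrable lborel V"
      unfolding V_def using f R by (intro shift_integral_integrable) auto
    then have [measurable]: "V \<in> borel_measurable borel" by auto
    have V_powr: "integrable lborel (\<lambda>x. \<bar>V x\<bar> powr s)"
      unfolding V_def by (rule shift_integral_powr_integrable[OF s R f fs])
    have V_bound: "(\<integral>x. \<bar>V x\<bar> powr s \<partial>lborel) \<le> C * integral\<^sup>L (lebesgue_on \<Omega>) (\<lambda>x. norm (g x) powr s)"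
      using shift_integral_powr_bound[OF s R f fs, of e] by (simp add: V_def C_def fs_eq)
    have restrict: "h \<in> borel_measurable (lebesgue_on \<Omega>)" if "h \<in> borel_measurable borel"
      for h :: "real^'n \<Rightarrow> 'b::euclidean_space"
      using that by (intro measurable_restrict_space1 measurable_completion) simp
    have v_norm: "norm (v x) powr s = \<bar>V x\<bar> powr s" for x by (simp add: v_def e)
    have ind_powr: "integrable lborel (\<lambda>x. indicator \<Omega> x * \<bar>V x\<bar> powr s)"
      using integrable_mult_indicator[of \<Omega> lborel "\<lambda>x. \<bar>V x\<bar> powr s"] V_powr by simp
    have v_powr_m: "(\<lambda>x. norm (v x) powr s) \<in> borel_measurable (lebesgue_on \<Omega>)"
      unfolding v_norm by (intro restrict) measurable
    have v_powr_eq: "AE x in lborel. indicator \<Omega> x * norm (v x) powr s = indicator \<Omega> x * \<bar>V x\<bar> powr s"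
      by (simp add: v_norm)
    have v_Lp: "in_Lp s \<Omega> v"
      unfolding in_Lp_def
    proof
      show "v \<in> borel_measurable (lebesgue_on \<Omega>)"
        unfolding v_def by (intro restrict) measurable
      show "integrable (lebesgue_on \<Omega>) (\<lambda>x. norm (v x) powr s)"
        using integrable_lebesgue_on_iff_lborel[OF \<Omega>m(1) v_powr_m _ v_powr_eq] ind_powr by simp
    qed
    have "integral\<^sup>L (lebesgue_on \<Omega>) (\<lambda>x. norm (v x) powr s) = (\<integral>x. indicator \<Omega> x * \<bar>V x\<bar> powr s \<partial>lborel)"
      using integral_lebesgue_on_eq_lborel[OF \<Omega>m(1) v_powr_m _ v_powr_eq] by simp
    also have "\<dots> \<le> (\<integral>x. \<bar>V x\<bar> powr s \<partial>lborel)"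
      using ind_powr V_powr by (intro integral_mono) (auto simp: indicator_def)
    also note V_bound
    finally have "Lp_norm s \<Omega> v \<le> (C * integral\<^sup>L (lebesgue_on \<Omega>) (\<lambda>x. norm (g x) powr s)) powr (1 / s)"
      unfolding Lp_norm_def using s by (intro powr_mono2) auto
    also have "\<dots> = C powr (1 / s) * Lp_norm s \<Omega> g"
      unfolding Lp_norm_def using C by (simp add: powr_mult)
    finally have v_bound: "Lp_norm s \<Omega> v \<le> C powr (1 / s) * Lp_norm s \<Omega> g" .
    have "is_weak_div \<Omega> v g"
      unfolding is_weak_div_def
    proof (intro conjI allI impI)
      show "g \<in> borel_measurable (lebesgue_on \<Omega>)" by (rule gm)
      fix \<phi> assume \<phi>: "test_fun \<Omega> \<phi>"
      obtain B where B: "B \<ge> 0" "\<And>x. \<bar>\<phi> x\<bar> \<le> B" using test_fun_bounded[OF \<phi>] by blast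
      obtain B' where B': "B' \<ge> 0" "\<And>x. \<bar>frechet_derivative \<phi> (at x) e\<bar> \<le> B'"
        using test_fun_deriv_bounded[OF \<phi>, of e] by blast
      have [measurable]: "\<phi> \<in> borel_measurable borel" "(\<lambda>x. frechet_derivative \<phi> (at x) e) \<in> borel_measurable borel"
        using test_fun_continuous[OF \<phi>] test_fun_deriv_continuous[OF \<phi>]
        by (auto intro: borel_measurable_continuous_onI)
      have \<phi>f_int: "integrable lborel (\<lambda>x. f x * \<phi> x)"
      proof (rule Bochner_Integration.integrable_bound)
        show "integrable lborel (\<lambda>x. B * f x)" using f by simp
        show "AE x in lborel. norm (f x * \<phi> x) \<le> norm (B * f x)"
          using B by (intro AE_I2) (auto simp: abs_mult mult.commute intro!: mult_right_mono)
      qed simp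
      have g\<phi>_m: "(\<lambda>x. g x * \<phi> x) \<in> borel_measurable (lebesgue_on \<Omega>)"
        using gm restrict[of \<phi>] by (intro borel_measurable_times) auto
      have g\<phi>_eq: "AE x in lborel. indicator \<Omega> x * (g x * \<phi> x) = f x * \<phi> x"
        using f_eq by eventually_elim (metis mult.assoc)
      show "integrable (lebesgue_on \<Omega>) (\<lambda>x. g x * \<phi> x)"
        using integrable_lebesgue_on_iff_lborel[OF \<Omega>m(1) g\<phi>_m _ g\<phi>_eq] \<phi>f_int by simp
      have lin: "frechet_derivative \<phi> (at x) (v x) = frechet_derivative \<phi> (at x) e * V x" for x
      proof -
        have "linear (frechet_derivative \<phi> (at x))"
          using test_fun_has_derivative[OF \<phi>] has_derivative_linear by blast
        then show ?thesis by (simp add: v_def linear_scale mult.commute)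
      qed
      have dV_int: "integrable lborel (\<lambda>x. frechet_derivative \<phi> (at x) e * V x)"
      proof (rule Bochner_Integration.integrable_bound)
        show "integrable lborel (\<lambda>x. B' * V x)" using V_int by simp
        show "AE x in lborel. norm (frechet_derivative \<phi> (at x) e * V x) \<le> norm (B' * V x)"
          using B' by (intro AE_I2) (auto simp: abs_mult intro!: mult_right_mono)
      qed measurable
      have dv_m: "(\<lambda>x. frechet_derivative \<phi> (at x) (v x)) \<in> borel_measurable (lebesgue_on \<Omega>)"
        unfolding lin by (intro restrict) measurable
      have dv_eq: "AE x in lborel. indicator \<Omega> x * frechet_derivative \<phi> (at x) (v x)
          = frechet_derivative \<phi> (at x) e * V x"
      proof (rule AE_I2)
        fix x
        show "indicator \<Omega> x * frechet_derivative \<phi> (at x) (v x) = frechet_derivative \<phi> (at x) e * V x"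
          using test_fun_deriv_outside[OF \<phi>, of x e] lin by (cases "x \<in> \<Omega>") auto
      qed
      show "integrable (lebesgue_on \<Omega>) (\<lambda>x. frechet_derivative \<phi> (at x) (v x))"
        using integrable_lebesgue_on_iff_lborel[OF \<Omega>m(1) dv_m _ dv_eq] dV_int by simp
      have "integral\<^sup>L (lebesgue_on \<Omega>) (\<lambda>x. frechet_derivative \<phi> (at x) (v x))
          = (\<integral>x. frechet_derivative \<phi> (at x) e * V x \<partial>lborel)"
        using integral_lebesgue_on_eq_lborel[OF \<Omega>m(1) dv_m _ dv_eq] by simp
      also have "\<dots> = (\<integral>y. f y * (\<phi> (y + R *\<^sub>R e) - \<phi> y) \<partial>lborel)"
        unfolding V_def using integral_deriv_shift[OF \<phi> f, of R e] R by simp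
      \<comment> \<open>For y in \<Omega> the end point y + R e lies outside \<Omega>, where \<phi>
        is zero; for almost every other y the factor f y is zero.\<close>
      also have "\<dots> = (\<integral>y. - (f y * \<phi> y) \<partial>lborel)"
      proof (rule integral_cong_AE)
        show "AE y in lborel. f y * (\<phi> (y + R *\<^sub>R e) - \<phi> y) = - (f y * \<phi> y)"
          using f_eq
        proof eventually_elim
          case (elim y)
          then show ?case
            using out[of y] test_fun_outside[OF \<phi>, of "y + R *\<^sub>R e"] by (cases "y \<in> \<Omega>") auto
        qed
      qed measurable
      also have "\<dots> = - integral\<^sup>L (lebesgue_on \<Omega>) (\<lambda>x. g x * \<phi> x)"
        using integral_lebesgue_on_eq_lborel[OF \<Omega>m(1) g\<phi>_m _ g\<phi>_eq] by simp
      finally show "integral\<^sup>L (lebesgue_on \<Omega>) (\<lambda>x. frechet_derivative \<phi> (at x) (v x))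
          = - integral\<^sup>L (lebesgue_on \<Omega>) (\<lambda>x. g x * \<phi> x)" .
    qed
    with v_Lp v_bound show ?thesis by blast
  qed
  then show ?thesis by (intro that[of "C powr (1 / s)"]) auto
qed

section \<open>Function spaces and dual norms\<close>

lemma powr_add_le_two_powr:
  fixes x y p :: real
  assumes "x \<ge> 0" "y \<ge> 0" "p \<ge> 0"
  shows "(x + y) powr p \<le> 2 powr p * (x powr p + y powr p)"
proof -
  have "(x + y) powr p \<le> (2 * max x y) powr p"
    using assms by (intro powr_mono2) auto
  also have "\<dots> = 2 powr p * max x y powr p" using assms by (simp add: powr_mult)
  also have "\<dots> \<le> 2 powr p * (x powr p + y powr p)"
    by (intro mult_left_mono) (auto simp: max_def)
  finally show ?thesis .
qed

lemma Lp_norm_nonneg [simp]: "Lp_norm p \<Omega> f \<ge> 0"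
  by (simp add: Lp_norm_def)

lemma V_norm_nonneg [simp]: "V_norm s \<Omega> v \<ge> 0"
  by (simp add: V_norm_def)

lemma W_norm_nonneg [simp]: "W_norm s \<Omega> w \<ge> 0"
  by (simp add: W_norm_def)

lemma Lp_norm_powr:
  "p > 0 \<Longrightarrow> Lp_norm p \<Omega> f powr p = integral\<^sup>L (lebesgue_on \<Omega>) (\<lambda>x. norm (f x) powr p)"
  by (simp add: Lp_norm_def powr_powr)

lemma in_Lp_zero [simp]: "in_Lp p \<Omega> (\<lambda>x. 0)"
  by (simp add: in_Lp_def)

lemma Lp_norm_zero [simp]: "Lp_norm p \<Omega> (\<lambda>x. 0) = 0"
  by (simp add: Lp_norm_def)

lemma in_Lp_scaleR:
  assumes "in_Lp p \<Omega> f"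
  shows "in_Lp p \<Omega> (\<lambda>x. c *\<^sub>R f x)"
proof -
  have "f \<in> borel_measurable (lebesgue_on \<Omega>)" using assms by (simp add: in_Lp_def)
  then have "(\<lambda>x. c *\<^sub>R f x) \<in> borel_measurable (lebesgue_on \<Omega>)" by measurable
  with assms show ?thesis by (simp add: in_Lp_def powr_mult)
qed

lemma in_Lp_add:
  assumes "in_Lp p \<Omega> f" "in_Lp p \<Omega> g" "p > 0"
  shows "in_Lp p \<Omega> (\<lambda>x. f x + g x)"
proof -
  have [measurable]: "f \<in> borel_measurable (lebesgue_on \<Omega>)" "g \<in> borel_measurable (lebesgue_on \<Omega>)"
    using assms by (simp_all add: in_Lp_def)
  have "integrable (lebesgue_on \<Omega>) (\<lambda>x. norm (f x + g x) powr p)"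
  proof (rule Bochner_Integration.integrable_bound)
    show "integrable (lebesgue_on \<Omega>) (\<lambda>x. 2 powr p * (norm (f x) powr p + norm (g x) powr p))"
      using assms by (simp add: in_Lp_def)
    have "norm (f x + g x) powr p \<le> 2 powr p * (norm (f x) powr p + norm (g x) powr p)" for x
      using powr_mono2[OF less_imp_le[OF assms(3)] norm_ge_zero norm_triangle_ineq[of "f x" "g x"]]
        powr_add_le_two_powr[of "norm (f x)" "norm (g x)" p] assms by simp
    then show "AE x in lebesgue_on \<Omega>. norm (norm (f x + g x) powr p)
        \<le> norm (2 powr p * (norm (f x) powr p + norm (g x) powr p))"
      by (intro AE_I2) simp
  qed measurable
  then show ?thesis by (simp add: in_Lp_def)
qed

lemma in_Lp_lincomb:
  "in_Lp p \<Omega> f \<Longrightarrow> in_Lp p \<Omega> g \<Longrightarrow> p > 0 \<Longrightarrow> in_Lp p \<Omega> (\<lambda>x. a *\<^sub>R f x + b *\<^sub>R g x)"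
  by (intro in_Lp_add in_Lp_scaleR)

lemma in_Lp_diff:
  "in_Lp p \<Omega> f \<Longrightarrow> in_Lp p \<Omega> g \<Longrightarrow> p > 0 \<Longrightarrow> in_Lp p \<Omega> (\<lambda>x. f x - g x)"
  using in_Lp_lincomb[of p \<Omega> f g 1 "-1"] by simp

lemma Lp_norm_scaleR:
  assumes "p > 0"
  shows "Lp_norm p \<Omega> (\<lambda>x. c *\<^sub>R f x) = \<bar>c\<bar> * Lp_norm p \<Omega> f"
  using assms by (simp add: Lp_norm_def powr_mult powr_powr)

lemma Lp_AE_cong:
  assumes "f \<in> borel_measurable (lebesgue_on \<Omega>)" "g \<in> borel_measurable (lebesgue_on \<Omega>)"
    and "AE x in lebesgue_on \<Omega>. f x = g x"
  shows in_Lp_AE_cong: "in_Lp p \<Omega> f \<longleftrightarrow> in_Lp p \<Omega> g"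
    and Lp_norm_AE_cong: "Lp_norm p \<Omega> f = Lp_norm p \<Omega> g"
proof -
  note [measurable] = assms(1,2)
  have eq: "AE x in lebesgue_on \<Omega>. norm (f x) powr p = norm (g x) powr p"
    using assms(3) by eventually_elim simp
  have "integrable (lebesgue_on \<Omega>) (\<lambda>x. norm (f x) powr p) \<longleftrightarrow> integrable (lebesgue_on \<Omega>) (\<lambda>x. norm (g x) powr p)"
    by (rule integrable_cong_AE[OF _ _ eq]) measurable
  then show "in_Lp p \<Omega> f \<longleftrightarrow> in_Lp p \<Omega> g" using assms by (simp add: in_Lp_def)
  have "integral\<^sup>L (lebesgue_on \<Omega>) (\<lambda>x. norm (f x) powr p) = integral\<^sup>L (lebesgue_on \<Omega>) (\<lambda>x. norm (g x) powr p)"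
    by (rule integral_cong_AE[OF _ _ eq]) measurable
  then show "Lp_norm p \<Omega> f = Lp_norm p \<Omega> g" by (simp add: Lp_norm_def)
qed

text \<open>The duality map of L^p: |q| = |f|^(p-1), and the conjugate exponent turns p - 1 into p.
  It is used with p = s for the divergence and with p = r for the pressure. In the second case p - 2
  is negative, which is harmless at zeros of f since \<open>0 powr a = 0\<close>.\<close>

lemma dual_power:
  fixes f :: "('n::finite) sfun"
  assumes p: "p > 1" and f: "in_Lp p \<Omega> f"
  defines "q \<equiv> \<lambda>x. f x * \<bar>f x\<bar> powr (p - 2)"
  shows "in_Lp (p / (p - 1)) \<Omega> q"
    and "f x * q x = \<bar>f x\<bar> powr p"
    and "Lp_norm (p / (p - 1)) \<Omega> q = Lp_norm p \<Omega> f powr (p - 1)"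
proof -
  have [measurable]: "f \<in> borel_measurable (lebesgue_on \<Omega>)" using f by (simp add: in_Lp_def)
  have q_m: "q \<in> borel_measurable (lebesgue_on \<Omega>)" unfolding q_def by measurable
  have q_abs: "norm (q x) = \<bar>f x\<bar> powr (p - 1)" for x
    using powr_add[of "\<bar>f x\<bar>" 1 "p - 2"] by (simp add: q_def abs_mult)
  have q_powr: "norm (q x) powr (p / (p - 1)) = norm (f x) powr p" for x
    using p q_abs[of x] by (simp add: powr_powr)
  show "in_Lp (p / (p - 1)) \<Omega> q"
    using f q_m by (simp only: in_Lp_def q_powr)
  show "f x * q x = \<bar>f x\<bar> powr p"
  proof -
    have "f x * q x = \<bar>f x\<bar> * (\<bar>f x\<bar> * \<bar>f x\<bar> powr (p - 2))"
      by (simp add: q_def mult.assoc[symmetric] abs_mult_self_eq)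
    also have "\<dots> = \<bar>f x\<bar> powr (1 + (1 + (p - 2)))"
      by (simp only: powr_add powr_one abs_ge_zero)
    finally show ?thesis by simp
  qed
  show "Lp_norm (p / (p - 1)) \<Omega> q = Lp_norm p \<Omega> f powr (p - 1)"
    using p by (simp only: Lp_norm_def q_powr) (simp add: powr_powr)
qed

text \<open>Membership only provides some weak divergence in L^s, and \<open>wdiv\<close> may be
  another one; uniqueness almost everywhere transfers the integrability.\<close>

lemma
  assumes "open \<Omega>" "v \<in> Wdiv_space s \<Omega>"
  shows Wdiv_space_weak_div: "is_weak_div \<Omega> v (wdiv \<Omega> v)"
    and Wdiv_space_in_Lp: "in_Lp s \<Omega> v"
    and Wdiv_space_wdiv_in_Lp: "in_Lp s \<Omega> (wdiv \<Omega> v)"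
proof -
  from assms obtain g where g: "in_Lp s \<Omega> v" "is_weak_div \<Omega> v g" "in_Lp s \<Omega> g"
    by (auto simp: Wdiv_space_def)
  then show w: "is_weak_div \<Omega> v (wdiv \<Omega> v)" "in_Lp s \<Omega> v" using is_weak_div_wdiv by auto
  show "in_Lp s \<Omega> (wdiv \<Omega> v)"
    using in_Lp_AE_cong[OF _ _ wdiv_AE_eq[OF assms(1) g(2)], of s] w g by (simp add: is_weak_div_def)
qed

lemma Wdiv_space_lincomb:
  assumes "open \<Omega>" "s > 0" "u \<in> Wdiv_space s \<Omega>" "v \<in> Wdiv_space s \<Omega>"
  shows "(\<lambda>x. a *\<^sub>R u x + b *\<^sub>R v x) \<in> Wdiv_space s \<Omega>"
  unfolding Wdiv_space_def mem_Collect_eq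
proof (intro conjI exI)
  show "in_Lp s \<Omega> (\<lambda>x. a *\<^sub>R u x + b *\<^sub>R v x)"
    using assms by (intro in_Lp_lincomb Wdiv_space_in_Lp) auto
  show "is_weak_div \<Omega> (\<lambda>x. a *\<^sub>R u x + b *\<^sub>R v x) (\<lambda>x. a * wdiv \<Omega> u x + b * wdiv \<Omega> v x)"
    using assms by (intro is_weak_div_lincomb Wdiv_space_weak_div) auto
  show "in_Lp s \<Omega> (\<lambda>x. a * wdiv \<Omega> u x + b * wdiv \<Omega> v x)"
    using in_Lp_lincomb[OF Wdiv_space_wdiv_in_Lp Wdiv_space_wdiv_in_Lp] assms by simp
qed

lemma Wdiv_space_diff:
  "open \<Omega> \<Longrightarrow> s > 0 \<Longrightarrow> u \<in> Wdiv_space s \<Omega> \<Longrightarrow> v \<in> Wdiv_space s \<Omega> \<Longrightarrow> (\<lambda>x. u x - v x) \<in> Wdiv_space s \<Omega>"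
  using Wdiv_space_lincomb[of \<Omega> s u v 1 "-1"] by simp

lemma Wdiv_space_zero [simp]: "(\<lambda>x. 0) \<in> Wdiv_space s \<Omega>"
  using is_weak_div_zero[of \<Omega>] by (auto simp: Wdiv_space_def intro!: exI[of _ "\<lambda>x. 0"])

lemma wdiv_measurable: "is_weak_div \<Omega> v g \<Longrightarrow> wdiv \<Omega> v \<in> borel_measurable (lebesgue_on \<Omega>)"
  using is_weak_div_wdiv is_weak_div_def by blast

lemma Lp_norm_wdiv_eq:
  assumes "open \<Omega>" "is_weak_div \<Omega> v g"
  shows "Lp_norm p \<Omega> (wdiv \<Omega> v) = Lp_norm p \<Omega> g"
  using assms by (intro Lp_norm_AE_cong wdiv_AE_eq wdiv_measurable) (auto simp: is_weak_div_def)

lemma V_norm_scaleR: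
  assumes "open \<Omega>" "s > 0" "v \<in> Wdiv_space s \<Omega>"
  shows "V_norm s \<Omega> (\<lambda>x. c *\<^sub>R v x) = \<bar>c\<bar> * V_norm s \<Omega> v"
proof -
  have "is_weak_div \<Omega> (\<lambda>x. c *\<^sub>R v x) (\<lambda>x. c * wdiv \<Omega> v x)"
    using is_weak_div_lincomb[OF Wdiv_space_weak_div[OF assms(1,3)] is_weak_div_zero, of c 0] by simp
  then have "Lp_norm s \<Omega> (wdiv \<Omega> (\<lambda>x. c *\<^sub>R v x)) = \<bar>c\<bar> * Lp_norm s \<Omega> (wdiv \<Omega> v)"
    using Lp_norm_wdiv_eq[OF assms(1)] Lp_norm_scaleR[OF assms(2), of \<Omega> c "wdiv \<Omega> v"] by simp
  then show ?thesis
    using assms Lp_norm_scaleR[OF assms(2), of \<Omega> c v]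
    by (simp add: V_norm_def powr_mult distrib_left[symmetric] powr_powr)
qed

text \<open>Comparison of the l^s and l^1 norms of a pair: in a^s = a a^(s-1) the second factor is
  enlarged to (a + b)^(s-1). It separates the part of the norm seen by monotonicity from the
  divergence.\<close>

lemma V_norm_le:
  assumes "s \<ge> 1"
  shows "V_norm s \<Omega> v \<le> Lp_norm s \<Omega> v + Lp_norm s \<Omega> (wdiv \<Omega> v)"
proof -
  define a b where "a = Lp_norm s \<Omega> v" and "b = Lp_norm s \<Omega> (wdiv \<Omega> v)"
  have ab: "a \<ge> 0" "b \<ge> 0" by (simp_all add: a_def b_def)
  have split: "x powr s = x * x powr (s - 1)" if "x \<ge> 0" for x :: real
    using that powr_add[of x 1 "s - 1"] by simp
  have "a powr s + b powr s \<le> a * (a + b) powr (s - 1) + b * (a + b) powr (s - 1)"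
    using ab assms by (simp only: split[of a] split[of b]) (intro add_mono mult_left_mono powr_mono2, auto)
  also have "\<dots> = (a + b) powr s" using ab split[of "a + b"] by (simp add: distrib_right)
  finally have "(a powr s + b powr s) powr (1 / s) \<le> ((a + b) powr s) powr (1 / s)"
    using assms by (intro powr_mono2) auto
  also have "\<dots> = a + b" using ab assms by (simp add: powr_powr)
  finally show ?thesis by (simp add: V_norm_def a_def b_def)
qed

lemma V_norm_zero:
  assumes "open \<Omega>"
  shows "V_norm s \<Omega> (\<lambda>x. 0) = 0"
  using Lp_norm_wdiv_eq[OF assms is_weak_div_zero, of s] by (simp add: V_norm_def)

text \<open>A real supremum bounds its members only if the set is bounded above, which the
  hypothesis with C provides. C may be negative, hence its absolute value in the proof.\<close>

lemma dual_norm_ge: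
  assumes "\<And>x. x \<in> S \<Longrightarrow> \<bar>L x\<bar> \<le> C * N x" "\<And>x. N x \<ge> 0" "x \<in> S" "N x \<le> 1"
  shows "\<bar>L x\<bar> \<le> dual_norm S N L"
proof -
  have "\<bar>L y\<bar> \<le> \<bar>C\<bar>" if "y \<in> S" "N y \<le> 1" for y
  proof -
    have "\<bar>L y\<bar> \<le> \<bar>C\<bar> * N y"
      using assms(1)[OF that(1)] abs_ge_self[of C] assms(2)[of y] by (meson mult_right_mono order_trans)
    also have "\<dots> \<le> \<bar>C\<bar> * 1" using that by (intro mult_left_mono) auto
    finally show ?thesis by simp
  qed
  then have "bdd_above ((\<lambda>x. \<bar>L x\<bar>) ` {x \<in> S. N x \<le> 1})" by (auto intro!: bdd_aboveI)
  then show ?thesis unfolding dual_norm_def using assms by (intro cSUP_upper) auto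
qed

lemma dual_norm_le:
  assumes "x \<in> S" "N x \<le> 1" "\<And>x. x \<in> S \<Longrightarrow> N x \<le> 1 \<Longrightarrow> \<bar>L x\<bar> \<le> B"
  shows "dual_norm S N L \<le> B"
  unfolding dual_norm_def using assms by (intro cSUP_least) auto

text \<open>Rescaling x to norm one gives the claim; when N x = 0 rescaling is impossible, but then
  boundedness forces L x = 0. Scalar multiplication is the parameter \<open>scl\<close>, so that one
  proof serves both V and Z.\<close>

lemma dual_norm_bound:
  assumes "\<And>x. x \<in> S \<Longrightarrow> \<bar>L x\<bar> \<le> C * N x" "\<And>x. N x \<ge> 0" "x \<in> S"
    and scl: "\<And>c. scl c x \<in> S" "\<And>c. N (scl c x) = \<bar>c\<bar> * N x" "\<And>c. L (scl c x) = c * L x"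
  shows "\<bar>L x\<bar> \<le> dual_norm S N L * N x"
proof (cases "N x = 0")
  case True
  with assms(1)[OF assms(3)] show ?thesis by simp
next
  case False
  then have N: "N x > 0" using assms(2)[of x] by simp
  have "\<bar>L (scl (1 / N x) x)\<bar> \<le> dual_norm S N L"
    by (rule dual_norm_ge[OF assms(1,2)]) (use N scl in auto)
  then show ?thesis using N by (simp add: scl field_simps)
qed

section \<open>Functionals on the product space and their two components\<close>

lemma W_norm_left: "W_norm s \<Omega> (v, \<lambda>x. 0) = V_norm s \<Omega> v"
  by (simp add: W_norm_def)

lemma W_norm_right: "open \<Omega> \<Longrightarrow> W_norm s \<Omega> (\<lambda>x. 0, q) = Lp_norm (s / (s - 1)) \<Omega> q"
  by (simp add: W_norm_def V_norm_zero)

lemma W_dual_bounded: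
  assumes "L \<in> W_dual s \<Omega>"
  obtains C where "\<And>w. w \<in> W_space s \<Omega> \<Longrightarrow> \<bar>L w\<bar> \<le> C * W_norm s \<Omega> w"
  using assms unfolding W_dual_def by blast

lemma W_dual_lincomb:
  assumes "L \<in> W_dual s \<Omega>" "(v, q) \<in> W_space s \<Omega>" "(v', q') \<in> W_space s \<Omega>"
  shows "L (\<lambda>x. a *\<^sub>R v x + b *\<^sub>R v' x, \<lambda>x. a * q x + b * q' x) = a * L (v, q) + b * L (v', q')"
  using assms unfolding W_dual_def by blast

lemma W_space_left: "v \<in> Wdiv_space s \<Omega> \<Longrightarrow> (v, \<lambda>x. 0) \<in> W_space s \<Omega>"
  by (simp add: W_space_def)

lemma W_space_right: "in_Lp (s / (s - 1)) \<Omega> q \<Longrightarrow> (\<lambda>x. 0, q) \<in> W_space s \<Omega>"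
  by (simp add: W_space_def)

lemma W_dual_split:
  assumes "L \<in> W_dual s \<Omega>" "(v, q) \<in> W_space s \<Omega>"
  shows "L (v, q) = L (v, \<lambda>x. 0) + L (\<lambda>x. 0, q)"
  using W_dual_lincomb[OF assms(1) W_space_left W_space_right, of v q 1 1] assms(2)
  by (simp add: W_space_def)

lemma W_dual_diff:
  assumes "L \<in> W_dual s \<Omega>" "L' \<in> W_dual s \<Omega>"
  shows "(\<lambda>w. L w - L' w) \<in> W_dual s \<Omega>"
proof -
  obtain C C' where "\<And>w. w \<in> W_space s \<Omega> \<Longrightarrow> \<bar>L w\<bar> \<le> C * W_norm s \<Omega> w"
    "\<And>w. w \<in> W_space s \<Omega> \<Longrightarrow> \<bar>L' w\<bar> \<le> C' * W_norm s \<Omega> w"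
    using assms W_dual_bounded by metis
  then have "\<bar>L w - L' w\<bar> \<le> (C + C') * W_norm s \<Omega> w" if "w \<in> W_space s \<Omega>" for w
    using that by (smt (verit) distrib_right)
  then have "\<exists>C. \<forall>w\<in>W_space s \<Omega>. \<bar>L w - L' w\<bar> \<le> C * W_norm s \<Omega> w" by blast
  then show ?thesis
    unfolding W_dual_def using W_dual_lincomb[OF assms(1)] W_dual_lincomb[OF assms(2)]
    by (simp add: algebra_simps)
qed

lemma W_dual_zero: "(\<lambda>w. 0) \<in> W_dual s \<Omega>"
  unfolding W_dual_def by (auto intro!: exI[of _ 0])

context
  fixes \<Omega> :: "(real^'n::finite) set" and s :: real and L
  assumes \<Omega>: "open \<Omega>" and s: "s > 1" and L: "L \<in> W_dual s \<Omega>"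
begin

lemma pi1_bound:
  assumes "v \<in> Wdiv_space s \<Omega>"
  shows "\<bar>L (v, \<lambda>x. 0)\<bar> \<le> V'_norm_pi1 s \<Omega> L * V_norm s \<Omega> v"
proof -
  obtain C where C: "\<And>w. w \<in> W_space s \<Omega> \<Longrightarrow> \<bar>L w\<bar> \<le> C * W_norm s \<Omega> w"
    using W_dual_bounded[OF L] by blast
  show ?thesis
    unfolding V'_norm_pi1_def
  proof (rule dual_norm_bound[where scl="\<lambda>c v x. c *\<^sub>R v x" and C=C])
    show "\<bar>L (v, \<lambda>x. 0)\<bar> \<le> C * V_norm s \<Omega> v" if "v \<in> Wdiv_space s \<Omega>" for v
      using C[OF W_space_left[OF that]] by (simp add: W_norm_left)
    show "(\<lambda>x. c *\<^sub>R v x) \<in> Wdiv_space s \<Omega>" for c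
      using Wdiv_space_lincomb[OF \<Omega> _ assms assms, of c 0] s by simp
    show "L (\<lambda>x. c *\<^sub>R v x, \<lambda>x. 0) = c * L (v, \<lambda>x. 0)" for c
      using W_dual_lincomb[OF L W_space_left[OF assms] W_space_left[OF assms], of c 0] by simp
  qed (use assms V_norm_scaleR[OF \<Omega>] s in auto)
qed

lemma pi2_bound:
  assumes "in_Lp (s / (s - 1)) \<Omega> q"
  shows "\<bar>L (\<lambda>x. 0, q)\<bar> \<le> Z'_norm_pi2 s \<Omega> L * Lp_norm (s / (s - 1)) \<Omega> q"
proof -
  obtain C where C: "\<And>w. w \<in> W_space s \<Omega> \<Longrightarrow> \<bar>L w\<bar> \<le> C * W_norm s \<Omega> w"
    using W_dual_bounded[OF L] by blast
  show ?thesis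
    unfolding Z'_norm_pi2_def
  proof (rule dual_norm_bound[where scl="\<lambda>c q x. c *\<^sub>R q x" and C=C])
    show "\<bar>L (\<lambda>x. 0, q)\<bar> \<le> C * Lp_norm (s / (s - 1)) \<Omega> q" if "q \<in> {q. in_Lp (s / (s - 1)) \<Omega> q}" for q
      using C[OF W_space_right] that \<Omega> by (simp add: W_norm_right)
    show "(\<lambda>x. c *\<^sub>R q x) \<in> {q. in_Lp (s / (s - 1)) \<Omega> q}" for c
      using in_Lp_scaleR[OF assms, of c] by simp
    show "L (\<lambda>x. 0, \<lambda>x. c *\<^sub>R q x) = c * L (\<lambda>x. 0, q)" for c
      using W_dual_lincomb[OF L W_space_right[OF assms] W_space_right[OF assms], of c 0] by simp
    show "Lp_norm (s / (s - 1)) \<Omega> (\<lambda>x. c *\<^sub>R q x) = \<bar>c\<bar> * Lp_norm (s / (s - 1)) \<Omega> q" for c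
      using s by (intro Lp_norm_scaleR) simp
  qed (use assms in auto)
qed

lemma W'_norm_ge: "w \<in> W_space s \<Omega> \<Longrightarrow> W_norm s \<Omega> w \<le> 1 \<Longrightarrow> \<bar>L w\<bar> \<le> W'_norm s \<Omega> L"
  unfolding W'_norm_def using W_dual_bounded[OF L] dual_norm_ge[of "W_space s \<Omega>" L _ "W_norm s \<Omega>"]
  by (metis W_norm_nonneg)

lemma pi2_ge:
  assumes "in_Lp (s / (s - 1)) \<Omega> q" "Lp_norm (s / (s - 1)) \<Omega> q \<le> 1"
  shows "\<bar>L (\<lambda>x. 0, q)\<bar> \<le> Z'_norm_pi2 s \<Omega> L"
proof -
  obtain C where C: "\<And>w. w \<in> W_space s \<Omega> \<Longrightarrow> \<bar>L w\<bar> \<le> C * W_norm s \<Omega> w"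
    using W_dual_bounded[OF L] by blast
  show ?thesis
    unfolding Z'_norm_pi2_def
  proof (rule dual_norm_ge[where C=C])
    show "\<bar>L (\<lambda>x. 0, q)\<bar> \<le> C * Lp_norm (s / (s - 1)) \<Omega> q" if "q \<in> {q. in_Lp (s / (s - 1)) \<Omega> q}" for q
      using C[OF W_space_right] that \<Omega> by (simp add: W_norm_right)
  qed (use assms in auto)
qed

lemma pi1_nonneg: "V'_norm_pi1 s \<Omega> L \<ge> 0"
proof -
  obtain C where C: "\<And>w. w \<in> W_space s \<Omega> \<Longrightarrow> \<bar>L w\<bar> \<le> C * W_norm s \<Omega> w"
    using W_dual_bounded[OF L] by blast
  have "\<bar>L (\<lambda>x. 0, \<lambda>x. 0)\<bar> \<le> V'_norm_pi1 s \<Omega> L"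
    unfolding V'_norm_pi1_def
  proof (rule dual_norm_ge[where C=C])
    show "\<bar>L (v, \<lambda>x. 0)\<bar> \<le> C * V_norm s \<Omega> v" if "v \<in> Wdiv_space s \<Omega>" for v
      using C[OF W_space_left[OF that]] by (simp add: W_norm_left)
  qed (use V_norm_zero[OF \<Omega>] in auto)
  then show ?thesis by linarith
qed

lemma pi2_nonneg: "Z'_norm_pi2 s \<Omega> L \<ge> 0"
  using pi2_ge[of "\<lambda>x. 0"] by simp

lemma W'_norm_nonneg: "W'_norm s \<Omega> L \<ge> 0"
  using W'_norm_ge[OF W_space_left[OF Wdiv_space_zero]] by (simp add: W_norm_left V_norm_zero \<Omega>)

lemma pi1_le_W'_norm: "V'_norm_pi1 s \<Omega> L \<le> W'_norm s \<Omega> L"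
  unfolding V'_norm_pi1_def
  by (rule dual_norm_le[of "\<lambda>x. 0"])
     (auto simp: V_norm_zero \<Omega> W_norm_left intro!: W'_norm_ge W_space_left)

lemma pi2_le_W'_norm: "Z'_norm_pi2 s \<Omega> L \<le> W'_norm s \<Omega> L"
  unfolding Z'_norm_pi2_def
  by (rule dual_norm_le[of "\<lambda>x. 0"])
     (auto simp: \<Omega> W_norm_right intro!: W'_norm_ge W_space_right)

end

text \<open>Yields \<gamma> \<le> M, the condition under which powers of \<gamma> can be traded for
  powers of M.\<close>

lemma pi2_diff_le:
  fixes \<Omega> :: "(real^'n::finite) set"
  assumes "open \<Omega>" "s > 1" "L \<in> W_dual s \<Omega>" "L' \<in> W_dual s \<Omega>"
  shows "Z'_norm_pi2 s \<Omega> (\<lambda>w. L w - L' w) \<le> Z'_norm_pi2 s \<Omega> L + Z'_norm_pi2 s \<Omega> L'"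
  unfolding Z'_norm_pi2_def[of _ _ "\<lambda>w. L w - L' w"]
proof (rule dual_norm_le[of "\<lambda>x. 0"])
  fix q :: "real^'n \<Rightarrow> real"
  assume "q \<in> {q. in_Lp (s / (s - 1)) \<Omega> q}" "Lp_norm (s / (s - 1)) \<Omega> q \<le> 1"
  then show "\<bar>L (\<lambda>x. 0, q) - L' (\<lambda>x. 0, q)\<bar> \<le> Z'_norm_pi2 s \<Omega> L + Z'_norm_pi2 s \<Omega> L'"
    using pi2_ge[OF assms(1,2,3), of q] pi2_ge[OF assms(1,2,4), of q] by simp
qed auto

section \<open>Estimates for the difference of two solutions\<close>

locale forchheimer =
  fixes \<Omega> :: "(real^'n::finite) set" and F :: "real^'n \<Rightarrow> real^'n" and s c1 c2 :: real
  assumes \<Omega>: "open \<Omega>" "bounded \<Omega>"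
    and s: "s > 2" and c1: "c1 > 0" and c2: "c2 > 0"
    and F0: "F 0 = 0"
    and Flip: "\<And>x y. norm (F x - F y) \<le> c1 * (1 + norm x powr (s-2) + norm y powr (s-2)) * norm (x - y)"
    and Fmon: "\<And>x y. (F x - F y) \<bullet> (x - y) \<ge> c2 * norm (x - y) powr s"
begin

text \<open>The growth factor stays bounded near each point, so F is locally Lipschitz there; this
  is wanted for the measurability of F composed with a velocity.\<close>

lemma F_continuous: "continuous_on UNIV F"
proof (simp add: continuous_on_eq_continuous_at, rule allI)
  fix x :: "real^'n"
  have "((\<lambda>y. c1 * (1 + norm y powr (s-2) + norm x powr (s-2)) * norm (y - x)) \<longlongrightarrow>
      c1 * (1 + norm x powr (s-2) + norm x powr (s-2)) * norm (x - x)) (at x)"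
    using s by (intro tendsto_intros) auto
  then have "((\<lambda>y. c1 * (1 + norm y powr (s-2) + norm x powr (s-2)) * norm (y - x)) \<longlongrightarrow> 0) (at x)"
    by simp
  then have "((\<lambda>y. F y - F x) \<longlongrightarrow> 0) (at x)"
    by (rule Lim_null_comparison[rotated]) (use Flip in auto)
  then show "isCont F x" by (simp add: isCont_def LIM_zero_cancel)
qed

lemma F_measurable [measurable]: "F \<in> borel_measurable borel"
  using F_continuous by (rule borel_measurable_continuous_onI)

lemma finite_measure_domain: "integrable (lebesgue_on \<Omega>) (\<lambda>x. c :: real)"
proof -
  have "emeasure lebesgue \<Omega> < \<infinity>" using \<Omega> emeasure_bounded_finite[of \<Omega>] by simp
  then show ?thesis
    using \<Omega> by (intro integrable_const finite_measure.integrable_const finite_measureI)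
      (auto simp: emeasure_restrict_space space_restrict_space)
qed

text \<open>The growth factor of F is at most 3 h^(s-2) with h = 1 + |u1| + |u2|, so the
  three-factor Hoelder inequality applies to h, u1 - u2 and v. Boundedness of \<Omega> is what puts
  the constant 1, and with it h, into L^s.\<close>

lemma F_diff_estimate:
  obtains K where "K \<ge> 0"
    "\<And>u1 u2 v :: 'n vfun. in_Lp s \<Omega> u1 \<Longrightarrow> in_Lp s \<Omega> u2 \<Longrightarrow> in_Lp s \<Omega> v \<Longrightarrow>
       integrable (lebesgue_on \<Omega>) (\<lambda>x. (F (u1 x) - F (u2 x)) \<bullet> v x) \<and>
       \<bar>\<integral>x. (F (u1 x) - F (u2 x)) \<bullet> v x \<partial>lebesgue_on \<Omega>\<bar>
         \<le> K * (1 + Lp_norm s \<Omega> u1 + Lp_norm s \<Omega> u2) powr (s - 2) * Lp_norm s \<Omega> (\<lambda>x. u1 x - u2 x) * Lp_norm s \<Omega> v"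
proof -
  let ?M = "lebesgue_on \<Omega>"
  define m where "m = (\<integral>x. (1::real) \<partial>?M)"
  have m: "m \<ge> 0" by (simp add: m_def)
  \<comment> \<open>Chosen so that the integral of h^s is at most D H^s, with H = 1 + ||u1|| +
    ||u2||. As H \<ge> 1, the measure m of \<Omega> is absorbed into m H^s, and each velocity adds
    another H^s.\<close>
  define D where "D = 4 powr s * (m + 2)"
  have D: "D > 0" using m by (simp add: D_def)
  have "integrable ?M (\<lambda>x. (F (u1 x) - F (u2 x)) \<bullet> v x) \<and>
       \<bar>\<integral>x. (F (u1 x) - F (u2 x)) \<bullet> v x \<partial>?M\<bar>
         \<le> 3 * c1 * (3 * (D powr (1 / s)) powr (s - 2)) * (1 + Lp_norm s \<Omega> u1 + Lp_norm s \<Omega> u2) powr (s - 2)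
             * Lp_norm s \<Omega> (\<lambda>x. u1 x - u2 x) * Lp_norm s \<Omega> v"
    if u: "in_Lp s \<Omega> u1" "in_Lp s \<Omega> u2" and v: "in_Lp s \<Omega> v" for u1 u2 v :: "'n vfun"
  proof -
    have [measurable]: "u1 \<in> borel_measurable ?M" "u2 \<in> borel_measurable ?M" "v \<in> borel_measurable ?M"
      using u v by (simp_all add: in_Lp_def)
    define H where "H = 1 + Lp_norm s \<Omega> u1 + Lp_norm s \<Omega> u2"
    have H: "H \<ge> 1" "Lp_norm s \<Omega> u1 \<le> H" "Lp_norm s \<Omega> u2 \<le> H" by (simp_all add: H_def)
    define h where "h x = 1 + norm (u1 x) + norm (u2 x)" for x
    have h_ge: "h x \<ge> 0" for x by (simp add: h_def add_nonneg_nonneg)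
    have h_le: "h x powr s \<le> 4 powr s * (1 + norm (u1 x) powr s + norm (u2 x) powr s)" for x
    proof -
      have "h x powr s \<le> (4 * max 1 (max (norm (u1 x)) (norm (u2 x)))) powr s"
        using s by (intro powr_mono2) (auto simp: h_def)
      also have "\<dots> = 4 powr s * max 1 (max (norm (u1 x)) (norm (u2 x))) powr s"
        by (simp add: powr_mult)
      also have "\<dots> \<le> 4 powr s * (1 + norm (u1 x) powr s + norm (u2 x) powr s)"
        by (intro mult_left_mono) (auto simp: max_def)
      finally show ?thesis .
    qed
    have [measurable]: "h \<in> borel_measurable ?M" unfolding h_def by measurable
    have rhs_int: "integrable ?M (\<lambda>x. 4 powr s * (1 + norm (u1 x) powr s + norm (u2 x) powr s))"
      using u finite_measure_domain[of 1] by (simp add: in_Lp_def)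
    have h_int: "integrable ?M (\<lambda>x. h x powr s)"
      by (rule Bochner_Integration.integrable_bound[OF rhs_int]) (use h_le in \<open>auto intro!: AE_I2\<close>)
    have "(\<integral>x. h x powr s \<partial>?M) \<le> (\<integral>x. 4 powr s * (1 + norm (u1 x) powr s + norm (u2 x) powr s) \<partial>?M)"
      using h_int rhs_int h_le by (intro integral_mono) auto
    also have "\<dots> = 4 powr s * (m + Lp_norm s \<Omega> u1 powr s + Lp_norm s \<Omega> u2 powr s)"
      using u finite_measure_domain[of 1] s by (simp add: in_Lp_def m_def Lp_norm_powr)
    also have "\<dots> \<le> 4 powr s * (m * H powr s + H powr s + H powr s)"
    proof (intro mult_left_mono add_mono)
      show "m \<le> m * H powr s" using H s m by (simp add: ge_one_powr_ge_zero mult_le_cancel_left1)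
    qed (use H s in \<open>auto intro!: powr_mono2\<close>)
    also have "\<dots> = D * H powr s" by (simp add: D_def algebra_simps)
    finally have "(\<integral>x. h x powr s \<partial>?M) powr (1 / s) \<le> (D * H powr s) powr (1 / s)"
      using s by (intro powr_mono2) auto
    also have "\<dots> = D powr (1 / s) * H" using D H s by (simp add: powr_mult powr_powr)
    finally have h_norm: "((\<integral>x. h x powr s \<partial>?M) powr (1 / s)) powr (s - 2) \<le> (D powr (1 / s) * H) powr (s - 2)"
      using s by (intro powr_mono2) auto
    have w: "in_Lp s \<Omega> (\<lambda>x. u1 x - u2 x)" using u s by (intro in_Lp_diff) auto
    have tri: "integrable ?M (\<lambda>x. h x powr (s - 2) * norm (u1 x - u2 x) * norm (v x))"
      "(\<integral>x. h x powr (s - 2) * norm (u1 x - u2 x) * norm (v x) \<partial>?M)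
        \<le> 3 * ((\<integral>x. h x powr s \<partial>?M) powr (1 / s)) powr (s - 2)
            * (\<integral>x. norm (u1 x - u2 x) powr s \<partial>?M) powr (1 / s) * (\<integral>x. norm (v x) powr s \<partial>?M) powr (1 / s)"
      by (rule Hoelder_weak_three[OF s], use h_ge h_int v w in \<open>auto simp: in_Lp_def\<close>)+
    have pt: "\<bar>(F (u1 x) - F (u2 x)) \<bullet> v x\<bar> \<le> 3 * c1 * (h x powr (s - 2) * norm (u1 x - u2 x) * norm (v x))" for x
    proof -
      \<comment> \<open>Each of the three summands is at most h^(s-2), the constant one because h
        \<ge> 1.\<close>
      have "1 + norm (u1 x) powr (s - 2) + norm (u2 x) powr (s - 2) \<le> h x powr (s - 2) + h x powr (s - 2) + h x powr (s - 2)"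
        using s by (intro add_mono powr_mono2) (auto simp: h_def ge_one_powr_ge_zero)
      then have hh: "1 + norm (u1 x) powr (s - 2) + norm (u2 x) powr (s - 2) \<le> 3 * h x powr (s - 2)" by simp
      have "\<bar>(F (u1 x) - F (u2 x)) \<bullet> v x\<bar> \<le> norm (F (u1 x) - F (u2 x)) * norm (v x)"
        by (rule Cauchy_Schwarz_ineq2)
      also have "\<dots> \<le> (c1 * (3 * h x powr (s - 2)) * norm (u1 x - u2 x)) * norm (v x)"
        using Flip[of "u1 x" "u2 x"] hh c1
        by (intro mult_right_mono order_trans[OF Flip] mult_left_mono) auto
      finally show ?thesis by (simp add: mult_ac)
    qed
    have int: "integrable ?M (\<lambda>x. (F (u1 x) - F (u2 x)) \<bullet> v x)"
    proof (rule Bochner_Integration.integrable_bound)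
      show "integrable ?M (\<lambda>x. 3 * c1 * (h x powr (s - 2) * norm (u1 x - u2 x) * norm (v x)))"
        using tri(1) by simp
      show "AE x in ?M. norm ((F (u1 x) - F (u2 x)) \<bullet> v x)
          \<le> norm (3 * c1 * (h x powr (s - 2) * norm (u1 x - u2 x) * norm (v x)))"
        using pt by (intro AE_I2) (simp, smt (verit) abs_ge_self)
    qed measurable
    have "\<bar>\<integral>x. (F (u1 x) - F (u2 x)) \<bullet> v x \<partial>?M\<bar> \<le> (\<integral>x. \<bar>(F (u1 x) - F (u2 x)) \<bullet> v x\<bar> \<partial>?M)"
      by (rule integral_abs_bound)
    also have "\<dots> \<le> (\<integral>x. 3 * c1 * (h x powr (s - 2) * norm (u1 x - u2 x) * norm (v x)) \<partial>?M)"
      using int tri(1) pt by (intro integral_mono) auto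
    also have "\<dots> = 3 * c1 * (\<integral>x. h x powr (s - 2) * norm (u1 x - u2 x) * norm (v x) \<partial>?M)"
      by simp
    also have "\<dots> \<le> 3 * c1 * (3 * (D powr (1 / s) * H) powr (s - 2) * Lp_norm s \<Omega> (\<lambda>x. u1 x - u2 x) * Lp_norm s \<Omega> v)"
    proof (intro mult_left_mono order_trans[OF tri(2)])
      show "3 * ((\<integral>x. h x powr s \<partial>?M) powr (1 / s)) powr (s - 2)
            * (\<integral>x. norm (u1 x - u2 x) powr s \<partial>?M) powr (1 / s) * (\<integral>x. norm (v x) powr s \<partial>?M) powr (1 / s)
          \<le> 3 * (D powr (1 / s) * H) powr (s - 2) * Lp_norm s \<Omega> (\<lambda>x. u1 x - u2 x) * Lp_norm s \<Omega> v"
        unfolding Lp_norm_def using h_norm by (intro mult_right_mono) auto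
    qed (use c1 in auto)
    also have "\<dots> = 3 * c1 * (3 * (D powr (1 / s)) powr (s - 2)) * H powr (s - 2)
             * Lp_norm s \<Omega> (\<lambda>x. u1 x - u2 x) * Lp_norm s \<Omega> v"
      using H by (simp add: powr_mult)
    finally show ?thesis using int by (simp add: H_def)
  qed
  then show ?thesis using c1 by (intro that[of "3 * c1 * (3 * (D powr (1 / s)) powr (s - 2))"]) auto
qed

lemma F_diff_integrable:
  fixes u1 u2 v :: "'n vfun"
  assumes "in_Lp s \<Omega> u1" "in_Lp s \<Omega> u2" "in_Lp s \<Omega> v"
  shows "integrable (lebesgue_on \<Omega>) (\<lambda>x. (F (u1 x) - F (u2 x)) \<bullet> v x)"
  by (rule F_diff_estimate) (use assms in blast)

lemma a_form_integrable:
  assumes "in_Lp s \<Omega> u" "in_Lp s \<Omega> v"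
  shows "integrable (lebesgue_on \<Omega>) (\<lambda>x. F (u x) \<bullet> v x)"
  using F_diff_integrable[OF assms(1) in_Lp_zero assms(2)] by (simp add: F0)

lemma a_form_diff:
  assumes "in_Lp s \<Omega> u1" "in_Lp s \<Omega> u2" "in_Lp s \<Omega> v"
  shows "a_form \<Omega> F u1 v - a_form \<Omega> F u2 v = (\<integral>x. (F (u1 x) - F (u2 x)) \<bullet> v x \<partial>lebesgue_on \<Omega>)"
  unfolding a_form_def using assms a_form_integrable by (simp add: inner_diff_left)

lemma a_form_monotone:
  assumes "in_Lp s \<Omega> u1" "in_Lp s \<Omega> u2"
  shows "c2 * Lp_norm s \<Omega> (\<lambda>x. u1 x - u2 x) powr s
      \<le> a_form \<Omega> F u1 (\<lambda>x. u1 x - u2 x) - a_form \<Omega> F u2 (\<lambda>x. u1 x - u2 x)"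
proof -
  have w: "in_Lp s \<Omega> (\<lambda>x. u1 x - u2 x)" using assms s by (intro in_Lp_diff) auto
  have "integrable (lebesgue_on \<Omega>) (\<lambda>x. (F (u1 x) - F (u2 x)) \<bullet> (u1 x - u2 x))"
    using assms w by (rule F_diff_integrable)
  then have "(\<integral>x. c2 * norm (u1 x - u2 x) powr s \<partial>lebesgue_on \<Omega>)
      \<le> (\<integral>x. (F (u1 x) - F (u2 x)) \<bullet> (u1 x - u2 x) \<partial>lebesgue_on \<Omega>)"
    using w Fmon by (intro integral_mono) (auto simp: in_Lp_def)
  then show ?thesis using s assms w by (simp add: a_form_diff Lp_norm_powr)
qed

section \<open>The divergence form b\<close>

lemma b_form_integrable:
  assumes "v \<in> Wdiv_space s \<Omega>" "in_Lp (s / (s - 1)) \<Omega> q"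
  shows "integrable (lebesgue_on \<Omega>) (\<lambda>x. wdiv \<Omega> v x * q x)"
proof -
  note d = Wdiv_space_wdiv_in_Lp[OF \<Omega>(1) assms(1)]
  have [measurable]: "wdiv \<Omega> v \<in> borel_measurable (lebesgue_on \<Omega>)" "q \<in> borel_measurable (lebesgue_on \<Omega>)"
    using d assms by (simp_all add: in_Lp_def)
  have "integrable (lebesgue_on \<Omega>) (\<lambda>x. \<bar>wdiv \<Omega> v x\<bar> * \<bar>q x\<bar>)"
    by (rule Hoelder_weak(1)[OF _ refl, of s]) (use d assms s in \<open>auto simp: in_Lp_def\<close>)
  then have "integrable (lebesgue_on \<Omega>) (\<lambda>x. norm (wdiv \<Omega> v x * q x))" by (simp add: abs_mult)
  then show ?thesis by (rule integrable_norm_cancel) measurable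
qed

lemma b_form_diff_right:
  assumes "v \<in> Wdiv_space s \<Omega>" "in_Lp (s / (s - 1)) \<Omega> p" "in_Lp (s / (s - 1)) \<Omega> q"
  shows "b_form \<Omega> v (\<lambda>x. p x - q x) = b_form \<Omega> v p - b_form \<Omega> v q"
  unfolding b_form_def using assms b_form_integrable by (simp add: right_diff_distrib)

text \<open>Removes the dependence on the choice in \<open>wdiv\<close>; both the linearity in v and
  the evaluation at a field built by the right inverse rely on it.\<close>

lemma b_form_cong:
  assumes "is_weak_div \<Omega> v g" "in_Lp (s / (s - 1)) \<Omega> q"
  shows "b_form \<Omega> v q = (\<integral>x. g x * q x \<partial>lebesgue_on \<Omega>)"
  unfolding b_form_def
proof (rule integral_cong_AE)
  have [measurable]: "wdiv \<Omega> v \<in> borel_measurable (lebesgue_on \<Omega>)" "g \<in> borel_measurable (lebesgue_on \<Omega>)"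
      "q \<in> borel_measurable (lebesgue_on \<Omega>)"
    using assms wdiv_measurable by (auto simp: in_Lp_def is_weak_div_def)
  show "(\<lambda>x. wdiv \<Omega> v x * q x) \<in> borel_measurable (lebesgue_on \<Omega>)"
    "(\<lambda>x. g x * q x) \<in> borel_measurable (lebesgue_on \<Omega>)" by measurable
  show "AE x in lebesgue_on \<Omega>. wdiv \<Omega> v x * q x = g x * q x"
    using wdiv_AE_eq[OF \<Omega>(1) assms(1)] by eventually_elim simp
qed

lemma b_form_diff_left:
  assumes "u \<in> Wdiv_space s \<Omega>" "v \<in> Wdiv_space s \<Omega>" "in_Lp (s / (s - 1)) \<Omega> q"
  shows "b_form \<Omega> (\<lambda>x. u x - v x) q = b_form \<Omega> u q - b_form \<Omega> v q"
proof -
  have "is_weak_div \<Omega> (\<lambda>x. u x - v x) (\<lambda>x. wdiv \<Omega> u x - wdiv \<Omega> v x)"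
    using is_weak_div_lincomb[OF Wdiv_space_weak_div[OF \<Omega>(1) assms(1)] Wdiv_space_weak_div[OF \<Omega>(1) assms(2)], of 1 "-1"]
    by simp
  from b_form_cong[OF this assms(3)] show ?thesis
    using assms b_form_integrable by (simp add: b_form_def left_diff_distrib)
qed

lemma b_form_zero_left: "in_Lp (s / (s - 1)) \<Omega> q \<Longrightarrow> b_form \<Omega> (\<lambda>x. 0) q = 0"
  using b_form_cong[OF is_weak_div_zero] by simp

lemma b_form_zero_right: "b_form \<Omega> v (\<lambda>x. 0) = 0"
  by (simp add: b_form_def)

lemma a_form_zero_right: "a_form \<Omega> F u (\<lambda>x. 0) = 0"
  by (simp add: a_form_def)

text \<open>With F 0 = 0 the zero pair is a solution for zero data, so any estimate for differences
  is also an a priori estimate.\<close>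

lemma solves_A_zero: "solves_A s \<Omega> F (\<lambda>x. 0) (\<lambda>x. 0) (\<lambda>w. 0)"
  unfolding solves_A_def
  using b_form_zero_left b_form_zero_right F0 by (auto simp: a_form_def W_space_def)

text \<open>Only real numbers survive this lemma; the remaining argument no longer mentions function
  spaces. Here x is the L^s norm and not the V norm, because monotonicity does not see the
  divergence, which \<gamma> controls separately.\<close>

lemma solution_difference_estimates:
  obtains K where "K \<ge> 0"
    "\<And>L1 L2 u1 p1 u2 p2. L1 \<in> W_dual s \<Omega> \<Longrightarrow> L2 \<in> W_dual s \<Omega> \<Longrightarrow>
      (u1, p1) \<in> W_space s \<Omega> \<Longrightarrow> (u2, p2) \<in> W_space s \<Omega> \<Longrightarrow>
      solves_A s \<Omega> F u1 p1 L1 \<Longrightarrow> solves_A s \<Omega> F u2 p2 L2 \<Longrightarrow>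
      (let \<beta> = V'_norm_pi1 s \<Omega> (\<lambda>w. L1 w - L2 w);
           \<gamma> = Z'_norm_pi2 s \<Omega> (\<lambda>w. L1 w - L2 w);
           x = Lp_norm s \<Omega> (\<lambda>x. u1 x - u2 x);
           y = Lp_norm (s / (s - 1)) \<Omega> (\<lambda>x. p1 x - p2 x)
       in V_norm s \<Omega> (\<lambda>x. u1 x - u2 x) \<le> x + \<gamma>
        \<and> c2 * x powr s \<le> \<beta> * (x + \<gamma>) + \<gamma> * y
        \<and> y \<le> K * ((1 + Lp_norm s \<Omega> u1 + Lp_norm s \<Omega> u2) powr (s - 2) * x + \<beta>))"
proof -
  have s1: "s > 1" using s by simp
  obtain K1 where K1: "K1 \<ge> 0"
    "\<And>u1 u2 v :: 'n vfun. in_Lp s \<Omega> u1 \<Longrightarrow> in_Lp s \<Omega> u2 \<Longrightarrow> in_Lp s \<Omega> v \<Longrightarrow>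
       \<bar>\<integral>x. (F (u1 x) - F (u2 x)) \<bullet> v x \<partial>lebesgue_on \<Omega>\<bar>
         \<le> K1 * (1 + Lp_norm s \<Omega> u1 + Lp_norm s \<Omega> u2) powr (s - 2) * Lp_norm s \<Omega> (\<lambda>x. u1 x - u2 x) * Lp_norm s \<Omega> v"
    by (rule F_diff_estimate) blast
  obtain K0 where K0: "K0 \<ge> 0" "\<And>g. in_Lp s \<Omega> g \<Longrightarrow>
     \<exists>v. in_Lp s \<Omega> v \<and> is_weak_div \<Omega> v g \<and> Lp_norm s \<Omega> v \<le> K0 * Lp_norm s \<Omega> g"
    by (rule weak_div_right_inverse[OF \<Omega> s1]) blast
  define r where "r = s / (s - 1)"
  have r: "r > 1" "r / (r - 1) = s" using s by (auto simp: r_def field_simps)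
  \<comment> \<open>K0 + 1 bounds both the L^s and the V norm of the lifted test field; K1 + 1 is a
    common factor for the growth term, which carries K1, and for \<beta>, which carries 1.\<close>
  define K where "K = (K0 + 1) * (K1 + 1)"
  have key: "V_norm s \<Omega> (\<lambda>x. u1 x - u2 x) \<le> x + \<gamma> \<and> c2 * x powr s \<le> \<beta> * (x + \<gamma>) + \<gamma> * y
        \<and> y \<le> K * ((1 + Lp_norm s \<Omega> u1 + Lp_norm s \<Omega> u2) powr (s - 2) * x + \<beta>)"
    if L: "L1 \<in> W_dual s \<Omega>" "L2 \<in> W_dual s \<Omega>"
      and up: "(u1, p1) \<in> W_space s \<Omega>" "(u2, p2) \<in> W_space s \<Omega>"
      and sol: "solves_A s \<Omega> F u1 p1 L1" "solves_A s \<Omega> F u2 p2 L2"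
      and \<beta>_def: "\<beta> = V'_norm_pi1 s \<Omega> (\<lambda>w. L1 w - L2 w)"
      and \<gamma>_def: "\<gamma> = Z'_norm_pi2 s \<Omega> (\<lambda>w. L1 w - L2 w)"
      and x_def: "x = Lp_norm s \<Omega> (\<lambda>x. u1 x - u2 x)"
      and y_def: "y = Lp_norm (s / (s - 1)) \<Omega> (\<lambda>x. p1 x - p2 x)"
    for L1 L2 u1 u2 p1 p2 \<beta> \<gamma> x y
  proof -
    define \<Lambda> where "\<Lambda> w = L1 w - L2 w" for w
    define w where "w x = u1 x - u2 x" for x
    define \<pi> where "\<pi> x = p1 x - p2 x" for x
    have \<Lambda>: "\<Lambda> \<in> W_dual s \<Omega>" unfolding \<Lambda>_def by (rule W_dual_diff[OF L])
    have \<beta>: "\<beta> = V'_norm_pi1 s \<Omega> \<Lambda>" "\<beta> \<ge> 0" using pi1_nonneg[OF \<Omega>(1) s1 \<Lambda>] by (simp_all add: \<beta>_def \<Lambda>_def[abs_def])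
    have \<gamma>: "\<gamma> = Z'_norm_pi2 s \<Omega> \<Lambda>" "\<gamma> \<ge> 0" using pi2_nonneg[OF \<Omega>(1) s1 \<Lambda>] by (simp_all add: \<gamma>_def \<Lambda>_def[abs_def])
    have u: "u1 \<in> Wdiv_space s \<Omega>" "u2 \<in> Wdiv_space s \<Omega>" and p: "in_Lp r \<Omega> p1" "in_Lp r \<Omega> p2"
      using up by (simp_all add: W_space_def r_def)
    note u_Lp = u[THEN Wdiv_space_in_Lp[OF \<Omega>(1)]]
    have w: "w \<in> Wdiv_space s \<Omega>" unfolding w_def using u s \<Omega> by (intro Wdiv_space_diff) auto
    have \<pi>: "in_Lp r \<Omega> \<pi>" unfolding \<pi>_def using p r by (intro in_Lp_diff) auto
    have w_Lp: "in_Lp s \<Omega> w" "in_Lp s \<Omega> (wdiv \<Omega> w)"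
      using w \<Omega> Wdiv_space_in_Lp Wdiv_space_wdiv_in_Lp by auto
    \<comment> \<open>The form a is nonlinear in the velocity, so only the b terms combine into
      terms of w and \<pi>.\<close>
    have \<Lambda>_eq: "\<Lambda> (v, q) = (a_form \<Omega> F u1 v - a_form \<Omega> F u2 v) - b_form \<Omega> v \<pi> + b_form \<Omega> w q"
      if "(v, q) \<in> W_space s \<Omega>" for v q
    proof -
      have "v \<in> Wdiv_space s \<Omega>" "in_Lp (s / (s - 1)) \<Omega> q" using that by (simp_all add: W_space_def)
      then have "b_form \<Omega> v \<pi> = b_form \<Omega> v p1 - b_form \<Omega> v p2" "b_form \<Omega> w q = b_form \<Omega> u1 q - b_form \<Omega> u2 q"
        unfolding \<pi>_def[abs_def] w_def[abs_def] using b_form_diff_right b_form_diff_left u p by (simp_all add: r_def)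
      then show ?thesis using sol[unfolded solves_A_def, rule_format, OF that] by (simp add: \<Lambda>_def)
    qed
    have div: "Lp_norm s \<Omega> (wdiv \<Omega> w) \<le> \<gamma>"
    proof -
      let ?g = "Lp_norm s \<Omega> (wdiv \<Omega> w)"
      let ?q = "\<lambda>x. wdiv \<Omega> w x * \<bar>wdiv \<Omega> w x\<bar> powr (s - 2)"
      note q = dual_power[OF s1 w_Lp(2)]
      have "?g powr s = b_form \<Omega> w ?q"
        using s by (simp add: b_form_def q(2) Lp_norm_powr)
      also have "\<dots> = \<Lambda> (\<lambda>x. 0, ?q)"
        using \<Lambda>_eq[OF W_space_right[OF q(1)]] b_form_zero_left \<pi> by (simp add: a_form_zero_right r_def)
      also have "\<dots> \<le> \<gamma> * ?g powr (s - 1)"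
        using pi2_bound[OF \<Omega>(1) s1 \<Lambda> q(1)] by (simp add: \<gamma> q(3))
      finally have "?g powr s \<le> \<gamma> * ?g powr (s - 1)" .
      moreover have "?g powr s = ?g * ?g powr (s - 1)"
        using powr_add[of ?g 1 "s - 1"] by simp
      ultimately show ?thesis using \<gamma>(2) by (cases "?g = 0") auto
    qed
    have V: "V_norm s \<Omega> w \<le> x + \<gamma>"
      using V_norm_le[of s \<Omega> w] div s by (simp add: x_def w_def[abs_def])
    have energy: "c2 * x powr s \<le> \<beta> * (x + \<gamma>) + \<gamma> * y"
    proof -
      have wp: "(w, \<pi>) \<in> W_space s \<Omega>" using w \<pi> by (simp add: W_space_def r_def)
      have "c2 * x powr s \<le> a_form \<Omega> F u1 w - a_form \<Omega> F u2 w"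
        using a_form_monotone[OF u_Lp] by (simp add: x_def w_def[abs_def])
      \<comment> \<open>Testing with the difference itself cancels the two b terms, so the pressure
        enters only through its pairing with the second data component.\<close>
      also have "\<dots> = \<Lambda> (w, \<lambda>x. 0) + \<Lambda> (\<lambda>x. 0, \<pi>)"
        using \<Lambda>_eq[OF wp] W_dual_split[OF \<Lambda> wp] by simp
      also have "\<dots> \<le> \<beta> * V_norm s \<Omega> w + \<gamma> * Lp_norm (s / (s - 1)) \<Omega> \<pi>"
        using pi1_bound[OF \<Omega>(1) s1 \<Lambda> w] pi2_bound[OF \<Omega>(1) s1 \<Lambda>, of \<pi>] \<pi> by (simp add: \<beta> \<gamma> r_def)
      also have "\<dots> \<le> \<beta> * (x + \<gamma>) + \<gamma> * y"
        using V \<beta> by (simp add: y_def \<pi>_def[abs_def] mult_left_mono)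
      finally show ?thesis .
    qed
    define A where "A = (1 + Lp_norm s \<Omega> u1 + Lp_norm s \<Omega> u2) powr (s - 2) * x"
    have A: "A \<ge> 0" by (simp add: A_def x_def)
    have y: "y = Lp_norm r \<Omega> \<pi>" by (simp add: y_def \<pi>_def[abs_def] r_def)
    have pressure: "y \<le> K * (A + \<beta>)"
    proof -
      let ?g = "\<lambda>x. \<pi> x * \<bar>\<pi> x\<bar> powr (r - 2)"
      \<comment> \<open>As r / (r - 1) = s, the dual power of \<pi> lies in L^s and is therefore an
        admissible divergence.\<close>
      note g = dual_power[OF r(1) \<pi>, unfolded r(2)]
      obtain v where v: "in_Lp s \<Omega> v" "is_weak_div \<Omega> v ?g" "Lp_norm s \<Omega> v \<le> K0 * Lp_norm s \<Omega> ?g"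
        using K0(2)[OF g(1)] by blast
      have vW: "v \<in> Wdiv_space s \<Omega>" using v g(1) by (auto simp: Wdiv_space_def)
      have v_norm: "Lp_norm s \<Omega> v \<le> (K0 + 1) * y powr (r - 1)"
        using v(3) by (simp add: g(3) y distrib_right add_increasing2)
      \<comment> \<open>The added 1 accounts for the divergence of v, whose L^s norm is
        y^(r-1).\<close>
      have V_norm: "V_norm s \<Omega> v \<le> (K0 + 1) * y powr (r - 1)"
        using V_norm_le[of s \<Omega> v] v(3) s Lp_norm_wdiv_eq[OF \<Omega>(1) v(2), of s] by (simp add: g(3) y distrib_right)
      have "y powr r = (\<integral>x. \<bar>\<pi> x\<bar> powr r \<partial>lebesgue_on \<Omega>)"
        using r(1) by (simp add: y Lp_norm_powr)
      also have "\<dots> = b_form \<Omega> v \<pi>"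
        using b_form_cong[OF v(2), of \<pi>] \<pi> g(2) by (simp add: r_def mult.commute)
      also have "\<dots> = (\<integral>x. (F (u1 x) - F (u2 x)) \<bullet> v x \<partial>lebesgue_on \<Omega>) - \<Lambda> (v, \<lambda>x. 0)"
        using \<Lambda>_eq[OF W_space_left[OF vW]] a_form_diff[OF u_Lp v(1)] by (simp add: b_form_zero_right)
      also have "\<dots> \<le> K1 * A * Lp_norm s \<Omega> v + \<beta> * V_norm s \<Omega> v"
        using K1(2)[OF u_Lp v(1)] pi1_bound[OF \<Omega>(1) s1 \<Lambda> vW] by (simp add: \<beta> A_def x_def mult.assoc)
      also have "\<dots> \<le> K1 * A * ((K0 + 1) * y powr (r - 1)) + \<beta> * ((K0 + 1) * y powr (r - 1))"
        using v_norm V_norm K1(1) A \<beta> by (intro add_mono mult_left_mono) auto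
      also have "\<dots> \<le> (K1 + 1) * A * ((K0 + 1) * y powr (r - 1)) + (K1 + 1) * \<beta> * ((K0 + 1) * y powr (r - 1))"
        using K1(1) K0(1) A \<beta> by (intro add_mono mult_right_mono) (auto simp: mult_le_cancel_right1 distrib_right)
      also have "\<dots> = K * (A + \<beta>) * y powr (r - 1)" by (simp add: K_def algebra_simps)
      finally have "y powr r \<le> K * (A + \<beta>) * y powr (r - 1)" .
      moreover have "y powr r = y * y powr (r - 1)"
        using powr_add[of y 1 "r - 1"] by (simp add: y)
      moreover have "K * (A + \<beta>) \<ge> 0" using K0 K1 A \<beta> by (simp add: K_def)
      moreover have "y \<ge> 0" by (simp add: y)
      ultimately show ?thesis by (cases "y = 0") auto
    qed
    show ?thesis using V energy pressure by (simp add: A_def w_def[abs_def])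
  qed
  show ?thesis
  proof (rule that)
    show "K \<ge> 0" using K0 K1 by (simp add: K_def)
  qed (unfold Let_def, rule key, assumption+, rule refl, rule refl, rule refl, rule refl)
qed

end

section \<open>From the inequalities to the continuity estimate\<close>

lemma powr_minus_one_mult:
  fixes x :: real
  shows "x \<ge> 0 \<Longrightarrow> x powr a = x * x powr (a - 1)"
  using powr_add[of x 1 "a - 1"] by simp

text \<open>If x > M, then 1, \<gamma> and \<beta> are bounded by x, x and x^(s-1). The energy
  inequality becomes c x^s \<le> T M x^(s-1), and x^(s-1) cancels.\<close>

lemma a_priori_bound:
  fixes s c K :: real
  assumes s: "s > 2" and c: "c > 0" and K: "K \<ge> 0"
  obtains C where "C \<ge> 1"
    "\<And>x y \<beta> \<gamma> M. 0 \<le> x \<Longrightarrow> 0 \<le> \<beta> \<Longrightarrow> 0 \<le> \<gamma> \<Longrightarrow> 1 \<le> M \<Longrightarrow> \<beta> \<le> M powr (s - 1) \<Longrightarrow> \<gamma> \<le> M \<Longrightarrow>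
      c * x powr s \<le> \<beta> * (x + \<gamma>) + \<gamma> * y \<Longrightarrow> y \<le> K * ((1 + x) powr (s - 2) * x + \<beta>) \<Longrightarrow> x \<le> C * M"
proof -
  \<comment> \<open>The leading 2 comes from x + \<gamma> \<le> 2 x, the power of 2 from 1 + x \<le>
    2 x, and the last 1 from \<beta> \<le> x^(s-1), all for x > M \<ge> 1.\<close>
  define T where "T = 2 + K * (2 powr (s - 2) + 1)"
  have T: "T \<ge> 0" using K by (simp add: T_def)
  have "x \<le> (1 + T / c) * M"
    if x: "0 \<le> x" and \<beta>: "0 \<le> \<beta>" "\<beta> \<le> M powr (s - 1)" and \<gamma>: "0 \<le> \<gamma>" "\<gamma> \<le> M" and M: "1 \<le> M"
      and en: "c * x powr s \<le> \<beta> * (x + \<gamma>) + \<gamma> * y" and y: "y \<le> K * ((1 + x) powr (s - 2) * x + \<beta>)"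
    for x y \<beta> \<gamma> M
  proof (cases "x \<le> M")
    case True
    then show ?thesis using T c M by (simp add: distrib_right add_increasing2)
  next
    case False
    then have xM: "x > M" "x > 0" "x \<ge> 1" using M by auto
    let ?X = "x powr (s - 1)"
    have X: "?X = x * x powr (s - 2)" using powr_minus_one_mult[of x "s - 1"] x by simp
    have MX: "M powr (s - 1) \<le> ?X" using xM M s by (intro powr_mono2) auto
    have "\<beta> * (x + \<gamma>) \<le> M powr (s - 1) * (2 * x)"
      using \<beta> \<gamma> xM by (intro mult_mono) auto
    \<comment> \<open>One factor M is kept and only M^(s-2) is enlarged to x^(s-2), so that the
      final bound is linear in M.\<close>
    also have "\<dots> = M * (2 * (M powr (s - 2) * x))"
      using powr_minus_one_mult[of M "s - 1"] M by simp
    also have "\<dots> \<le> M * (2 * (x powr (s - 2) * x))"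
      using M xM s by (intro mult_left_mono mult_right_mono powr_mono2) auto
    finally have 1: "\<beta> * (x + \<gamma>) \<le> 2 * (M * ?X)" by (simp add: X mult_ac)
    have "y \<le> K * ((2 * x) powr (s - 2) * x + ?X)"
      using \<beta> MX xM s K by (intro order_trans[OF y] mult_left_mono add_mono mult_right_mono powr_mono2) auto
    also have "\<dots> = K * (2 powr (s - 2) + 1) * ?X"
      using x by (simp add: X powr_mult algebra_simps)
    finally have "\<gamma> * y \<le> M * (K * (2 powr (s - 2) + 1) * ?X)"
      using \<gamma> K M by (intro order_trans[OF mult_left_mono mult_right_mono]) auto
    with 1 en have "c * x powr s \<le> T * M * ?X" by (simp add: T_def algebra_simps)
    then have "(c * x) * ?X \<le> (T * M) * ?X" using powr_minus_one_mult[OF x, of s] by simp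
    then have "c * x \<le> T * M" using xM by (simp add: mult_le_cancel_right)
    then have "x \<le> T / c * M" using c by (simp add: field_simps)
    then show ?thesis using M by (simp add: distrib_right)
  qed
  moreover have "1 + T / c \<ge> 1" using T c by simp
  ultimately show ?thesis using that by metis
qed

text \<open>Eliminating y leaves x^s bounded by a multiple of T x + \<beta> \<gamma> with T =
  \<beta> + \<gamma> M^(s-2). If T x dominates, x^(s-1) is at most a multiple of T, and the power r
  - 1 solves for x. If \<beta> \<gamma> dominates, it is at most the s-th power of the larger of
  \<beta>^(r-1) and \<gamma>.\<close>

lemma solution_difference_bound:
  fixes s c K :: real
  assumes s: "s > 2" and c: "c > 0" and K: "K \<ge> 0"
  defines "r \<equiv> s / (s - 1)"
  obtains C where "C > 0"
    "\<And>x y \<beta> \<gamma> M. 0 \<le> x \<Longrightarrow> 0 \<le> \<beta> \<Longrightarrow> 0 \<le> \<gamma> \<Longrightarrow> 1 \<le> M \<Longrightarrow> \<gamma> \<le> M \<Longrightarrow>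
      c * x powr s \<le> \<beta> * (x + \<gamma>) + \<gamma> * y \<Longrightarrow> y \<le> K * (M powr (s - 2) * x + \<beta>) \<Longrightarrow>
      (x + \<gamma>) + y \<le> C * (\<beta> + M powr (s - 2) * \<beta> powr (r - 1) + \<gamma> + M powr (r * (s - 2)) * \<gamma> powr (r - 1))"
proof -
  have r: "1 < r" "r < 2" "(r - 1) * (s - 1) = 1" "(s - 2) + (2 - r) = r * (s - 2)" "(s - 2) + (s - 2) * (r - 1) = r * (s - 2)"
    using s by (auto simp: r_def field_simps)
  \<comment> \<open>1 + K comes from eliminating y, and the 2 from replacing a sum of two terms by
    twice the larger one.\<close>
  define \<kappa> where "\<kappa> = 2 * (1 + K) / c"
  have \<kappa>: "\<kappa> > 0" using K c by (simp add: \<kappa>_def)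
  \<comment> \<open>One summand for each of the two cases, T x or \<beta> \<gamma>
    dominating.\<close>
  define A where "A = \<kappa> powr (r - 1) * 2 powr (r - 1) + \<kappa> powr (1 / s)"
  have A: "A \<ge> 0" by (simp add: A_def)
  have "(x + \<gamma>) + y \<le> (2 * A + 1 + K * (2 * A + 1)) *
      (\<beta> + M powr (s - 2) * \<beta> powr (r - 1) + \<gamma> + M powr (r * (s - 2)) * \<gamma> powr (r - 1))"
    if x: "0 \<le> x" and \<beta>: "0 \<le> \<beta>" and \<gamma>: "0 \<le> \<gamma>" "\<gamma> \<le> M" and M: "1 \<le> M"
      and en: "c * x powr s \<le> \<beta> * (x + \<gamma>) + \<gamma> * y" and y: "y \<le> K * (M powr (s - 2) * x + \<beta>)"
    for x y \<beta> \<gamma> M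
  proof -
    define T where "T = \<beta> + \<gamma> * M powr (s - 2)"
    have T: "T \<ge> 0" using \<beta> \<gamma> by (simp add: T_def)
    \<comment> \<open>The first two terms bound T^(r-1) up to the factor 2^(r-1); the last is needed
      when \<beta> \<gamma> dominates.\<close>
    define E where "E = \<beta> powr (r - 1) + M powr ((s - 2) * (r - 1)) * \<gamma> powr (r - 1) + \<gamma>"
    have E: "E \<ge> 0" using \<gamma> by (simp add: E_def)
    have "c * x powr s \<le> \<beta> * (x + \<gamma>) + \<gamma> * (K * (M powr (s - 2) * x + \<beta>))"
      using en mult_left_mono[OF y \<gamma>(1)] by linarith
    also have "\<dots> = (\<beta> + K * (\<gamma> * M powr (s - 2))) * x + (1 + K) * (\<beta> * \<gamma>)"
      by (simp add: algebra_simps)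
    also have "\<dots> \<le> ((1 + K) * T) * x + (1 + K) * (\<beta> * \<gamma>)"
      using x K \<beta> \<gamma> by (intro add_mono mult_right_mono) (auto simp: T_def algebra_simps)
    finally have "c * x powr s \<le> (1 + K) * (T * x + \<beta> * \<gamma>)" by (simp add: algebra_simps)
    then have en': "x powr s \<le> \<kappa> / 2 * (T * x + \<beta> * \<gamma>)"
      using c by (simp add: \<kappa>_def field_simps)
    have "x \<le> A * E"
    proof (cases "\<beta> * \<gamma> \<le> T * x")
      case True
      show ?thesis
      proof (cases "x = 0")
        case False
        then have "x > 0" using x by simp
        have "x powr s \<le> \<kappa> / 2 * (T * x + T * x)"
          using \<kappa> True T by (intro order_trans[OF en'] mult_left_mono add_mono) auto
        then have "x powr (s - 1) * x \<le> \<kappa> * T * x"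
          using powr_minus_one_mult[OF x, of s] by (simp add: algebra_simps)
        then have "x powr (s - 1) \<le> \<kappa> * T" using \<open>x > 0\<close> by simp
        then have "(x powr (s - 1)) powr (r - 1) \<le> (\<kappa> * T) powr (r - 1)"
          using r by (intro powr_mono2) auto
        then have "x \<le> \<kappa> powr (r - 1) * T powr (r - 1)"
          using x r(3) \<kappa> T by (simp add: powr_powr powr_mult mult.commute)
        also have "\<dots> \<le> \<kappa> powr (r - 1) * (2 powr (r - 1) * (\<beta> powr (r - 1) + (\<gamma> * M powr (s - 2)) powr (r - 1)))"
          unfolding T_def using \<beta> \<gamma> r by (intro mult_left_mono powr_add_le_two_powr) auto
        also have "\<dots> \<le> \<kappa> powr (r - 1) * (2 powr (r - 1) * E)"
          using \<gamma> by (intro mult_left_mono) (auto simp: E_def powr_mult powr_powr mult.commute)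
        also have "\<dots> \<le> A * E" using E by (simp add: A_def distrib_right)
        finally show ?thesis .
      qed (use A E in simp)
    next
      case False
      \<comment> \<open>Since \<beta> = b^(s-1), the product \<beta> \<gamma> has degree s in b and
        \<gamma> together.\<close>
      define b where "b = \<beta> powr (r - 1)"
      define m where "m = max b \<gamma>"
      have b: "b \<ge> 0" "b powr (s - 1) = \<beta>" using \<beta> r(3) by (simp_all add: b_def powr_powr)
      have m: "m \<ge> 0" "b \<le> m" "\<gamma> \<le> m" using \<gamma> by (auto simp: m_def)
      have "\<beta> * \<gamma> \<le> m powr (s - 1) * m"
        using m b \<gamma> s by (subst b(2)[symmetric]) (intro mult_mono powr_mono2, auto)
      also have "\<dots> = m powr s" using powr_minus_one_mult[OF m(1), of s] by simp
      finally have m_ge: "\<beta> * \<gamma> \<le> m powr s" .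
      have "x powr s \<le> \<kappa> / 2 * (m powr s + m powr s)"
        using \<kappa> False m_ge by (intro order_trans[OF en'] mult_left_mono add_mono) auto
      then have "(x powr s) powr (1 / s) \<le> (\<kappa> * m powr s) powr (1 / s)"
        using s by (intro powr_mono2) auto
      then have "x \<le> \<kappa> powr (1 / s) * m"
        using x m s \<kappa> by (simp add: powr_powr powr_mult)
      also have "\<dots> \<le> \<kappa> powr (1 / s) * E"
        using \<gamma> by (intro mult_left_mono) (auto simp: E_def m_def b_def add_increasing2 add_increasing)
      also have "\<dots> \<le> A * E" using E by (simp add: A_def distrib_right)
      finally show ?thesis .
    qed
    let ?M = "M powr (s - 2)"
    have M1: "?M \<ge> 1" using M s by (simp add: ge_one_powr_ge_zero)
    define Q where "Q = \<beta> + ?M * \<beta> powr (r - 1) + \<gamma> + M powr (r * (s - 2)) * \<gamma> powr (r - 1)"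
    have "\<gamma> = \<gamma> powr (2 - r) * \<gamma> powr (r - 1)"
      using \<gamma> powr_add[of \<gamma> "2 - r" "r - 1"] by simp
    also have "\<dots> \<le> M powr (2 - r) * \<gamma> powr (r - 1)"
      using \<gamma> r by (intro mult_right_mono powr_mono2) auto
    finally have "?M * \<gamma> \<le> ?M * (M powr (2 - r) * \<gamma> powr (r - 1))" by (intro mult_left_mono) auto
    also have "\<dots> = M powr (r * (s - 2)) * \<gamma> powr (r - 1)"
      using powr_add[of M "s - 2" "2 - r"] r(4) by (simp add: mult.assoc)
    finally have M\<gamma>: "?M * \<gamma> \<le> M powr (r * (s - 2)) * \<gamma> powr (r - 1)" .
    \<comment> \<open>The pressure bound contains M^(s-2) x, so M^(s-2) E has to be compared with Q.
      The factor 2 arises because the \<gamma>^(r-1) term of Q is used twice.\<close>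
    have "?M * E = ?M * \<beta> powr (r - 1) + M powr (r * (s - 2)) * \<gamma> powr (r - 1) + ?M * \<gamma>"
      using powr_add[of M "s - 2" "(s - 2) * (r - 1)"] r(5) by (simp add: E_def distrib_left mult.assoc)
    also have "\<dots> \<le> 2 * Q"
      using M\<gamma> \<beta> \<gamma> by (simp add: Q_def algebra_simps add_increasing add_increasing2)
    finally have ME: "?M * E \<le> 2 * Q" .
    have "E \<le> ?M * E" using M1 E by (simp add: mult_le_cancel_right1)
    with ME have "A * E \<le> A * (2 * Q)" using A by (intro mult_left_mono) auto
    with \<open>x \<le> A * E\<close> have xQ: "x \<le> 2 * A * Q" by simp
    have "?M * x \<le> ?M * (A * E)" using \<open>x \<le> A * E\<close> by (intro mult_left_mono) auto
    also have "\<dots> = A * (?M * E)" by simp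
    also have "\<dots> \<le> A * (2 * Q)" using A ME by (intro mult_left_mono) auto
    finally have Mx: "?M * x \<le> 2 * A * Q" by simp
    have \<beta>Q: "\<beta> \<le> Q" and \<gamma>Q: "\<gamma> \<le> Q"
      using \<beta> \<gamma> by (simp_all add: Q_def add_increasing add_increasing2)
    have "y \<le> K * (2 * A * Q + Q)"
      using Mx \<beta>Q K by (intro order_trans[OF y] mult_left_mono add_mono) auto
    with xQ \<gamma>Q have "(x + \<gamma>) + y \<le> (2 * A + 1 + K * (2 * A + 1)) * Q"
      by (simp add: algebra_simps)
    then show ?thesis by (simp add: Q_def)
  qed
  moreover have "2 * A + 1 + K * (2 * A + 1) > 0" using A K by (simp add: add_pos_nonneg)
  ultimately show ?thesis using that by metis
qed

text \<open>Since 3 N \<ge> 1 and s - 2 \<le> r (s - 2), both powers of M are below the single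
  quantity P \<ge> 1. Two terms then fall under P D^(r-1), and \<beta> and \<gamma> under P
  D.\<close>

lemma total_norm_bound:
  fixes s M N D \<beta> \<gamma> :: real
  assumes s: "s > 2" and "0 \<le> \<beta>" "\<beta> \<le> D" "0 \<le> \<gamma>" "\<gamma> \<le> D" "0 \<le> M" "M \<le> 3 * N" "1 \<le> N"
  defines "r \<equiv> s / (s - 1)"
  shows "\<beta> + M powr (s - 2) * \<beta> powr (r - 1) + \<gamma> + M powr (r * (s - 2)) * \<gamma> powr (r - 1)
    \<le> 2 * 3 powr (r * (s - 2)) * N powr (r * (s - 2)) * (D powr (r - 1) + D)"
proof -
  define P where "P = (3 * N) powr (r * (s - 2))"
  have r: "r > 1" using s by (simp add: r_def)
  have e: "s - 2 \<le> r * (s - 2)" "0 \<le> r * (s - 2)" using r s by (auto simp: mult_le_cancel_right1)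
  have P1: "P \<ge> 1" unfolding P_def using assms e by (intro ge_one_powr_ge_zero) auto
  have "M powr (s - 2) \<le> (3 * N) powr (s - 2)" using assms by (intro powr_mono2) auto
  also have "\<dots> \<le> P" unfolding P_def using assms e by (intro powr_mono) auto
  finally have 1: "M powr (s - 2) * \<beta> powr (r - 1) \<le> P * D powr (r - 1)"
    using assms r P1 by (intro mult_mono powr_mono2) auto
  have "M powr (r * (s - 2)) \<le> P" unfolding P_def using assms e by (intro powr_mono2) auto
  then have 2: "M powr (r * (s - 2)) * \<gamma> powr (r - 1) \<le> P * D powr (r - 1)"
    using assms r P1 by (intro mult_mono powr_mono2) auto
  have "D \<le> P * D" using P1 assms by (simp add: mult_le_cancel_right1)
  with 1 2 assms have "\<beta> + M powr (s - 2) * \<beta> powr (r - 1) + \<gamma> + M powr (r * (s - 2)) * \<gamma> powr (r - 1)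
      \<le> 2 * P * (D powr (r - 1) + D)" by (simp add: algebra_simps)
  then show ?thesis using assms by (simp add: P_def powr_mult mult_ac)
qed

text \<open>Applied with a = r - 1, which lies in [0, 1], it makes M at most linear in the dual
  norms.\<close>

lemma powr_le_one_plus:
  fixes t a :: real
  assumes "t \<ge> 0" "0 \<le> a" "a \<le> 1"
  shows "t powr a \<le> 1 + t"
proof (cases "t \<le> 1")
  case True
  then show ?thesis using assms powr_le1[of a t] by simp
next
  case False
  then have "t powr a \<le> t powr 1" using assms by (intro powr_mono) auto
  with assms show ?thesis by simp
qed

theorem mainTheorem18:
  fixes \<Omega> :: "(real^'n) set" and F :: "real^'n \<Rightarrow> real^'n" and s c1 c2 :: real
  assumes n2: "CARD('n) \<ge> 2"
    and \<Omega>: "open \<Omega>" "bounded \<Omega>" "C1_boundary \<Omega>"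
    and s: "s > 2" and c1: "c1 > 0" and c2: "c2 > 0"
    and F0: "F 0 = 0"
    and Flip: "\<And>x y. norm (F x - F y) \<le> c1 * (1 + norm x powr (s-2) + norm y powr (s-2)) * norm (x - y)"
    and Fmon: "\<And>x y. (F x - F y) \<bullet> (x - y) \<ge> c2 * norm (x - y) powr s"
  shows "\<exists>c10 c11. c10 > 0 \<and> c11 > 0 \<and>
    (\<forall>L1 L2 u1 p1 u2 p2.
      L1 \<in> W_dual s \<Omega> \<longrightarrow> L2 \<in> W_dual s \<Omega> \<longrightarrow>
      (u1, p1) \<in> W_space s \<Omega> \<longrightarrow> (u2, p2) \<in> W_space s \<Omega> \<longrightarrow>
      solves_A s \<Omega> F u1 p1 L1 \<longrightarrow> solves_A s \<Omega> F u2 p2 L2 \<longrightarrow>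
      (let r = s / (s - 1);
           M = 1 + (V'_norm_pi1 s \<Omega> L1 powr (r - 1) + Z'_norm_pi2 s \<Omega> L1)
                 + (V'_norm_pi1 s \<Omega> L2 powr (r - 1) + Z'_norm_pi2 s \<Omega> L2);
           \<beta> = V'_norm_pi1 s \<Omega> (\<lambda>w. L1 w - L2 w);
           \<gamma> = Z'_norm_pi2 s \<Omega> (\<lambda>w. L1 w - L2 w);
           d = W_norm s \<Omega> (\<lambda>x. u1 x - u2 x, \<lambda>x. p1 x - p2 x);
           D = W'_norm s \<Omega> (\<lambda>w. L1 w - L2 w)
       in d \<le> c10 * (\<beta> + M powr (s - 2) * \<beta> powr (r - 1) + \<gamma> + M powr (r * (s - 2)) * \<gamma> powr (r - 1))
        \<and> d \<le> c11 * (1 + W'_norm s \<Omega> L1 + W'_norm s \<Omega> L2) powr (r * (s - 2))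
                 * (D powr (r - 1) + D)))"
proof -
  interpret forchheimer \<Omega> F s c1 c2
    by unfold_locales (use assms in auto)
  have s1: "s > 1" using s by simp
  define r where "r = s / (s - 1)"
  have r: "1 < r" "r < 2" "(r - 1) * (s - 1) = 1" using s by (auto simp: r_def field_simps)
  obtain K where K: "K \<ge> 0" and est:
    "\<And>L1 L2 u1 p1 u2 p2. L1 \<in> W_dual s \<Omega> \<Longrightarrow> L2 \<in> W_dual s \<Omega> \<Longrightarrow>
      (u1, p1) \<in> W_space s \<Omega> \<Longrightarrow> (u2, p2) \<in> W_space s \<Omega> \<Longrightarrow>
      solves_A s \<Omega> F u1 p1 L1 \<Longrightarrow> solves_A s \<Omega> F u2 p2 L2 \<Longrightarrow>
      (let \<beta> = V'_norm_pi1 s \<Omega> (\<lambda>w. L1 w - L2 w);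
           \<gamma> = Z'_norm_pi2 s \<Omega> (\<lambda>w. L1 w - L2 w);
           x = Lp_norm s \<Omega> (\<lambda>x. u1 x - u2 x);
           y = Lp_norm (s / (s - 1)) \<Omega> (\<lambda>x. p1 x - p2 x)
       in V_norm s \<Omega> (\<lambda>x. u1 x - u2 x) \<le> x + \<gamma>
        \<and> c2 * x powr s \<le> \<beta> * (x + \<gamma>) + \<gamma> * y
        \<and> y \<le> K * ((1 + Lp_norm s \<Omega> u1 + Lp_norm s \<Omega> u2) powr (s - 2) * x + \<beta>))"
    by (rule solution_difference_estimates) blast
  obtain B where B: "B \<ge> 1" and apriori:
    "\<And>x y \<beta> \<gamma> M. 0 \<le> x \<Longrightarrow> 0 \<le> \<beta> \<Longrightarrow> 0 \<le> \<gamma> \<Longrightarrow> 1 \<le> M \<Longrightarrow> \<beta> \<le> M powr (s - 1) \<Longrightarrow> \<gamma> \<le> M \<Longrightarrow>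
      c2 * x powr s \<le> \<beta> * (x + \<gamma>) + \<gamma> * y \<Longrightarrow> y \<le> K * ((1 + x) powr (s - 2) * x + \<beta>) \<Longrightarrow> x \<le> B * M"
    by (rule a_priori_bound[OF s c2 K]) blast
  \<comment> \<open>Both velocities are at most B M, so the growth factor is at most ((1 + 2 B)
    M)^(s-2); the added 1 covers \<beta>.\<close>
  define K' where "K' = K * ((1 + 2 * B) powr (s - 2) + 1)"
  have K': "K' \<ge> 0" using K by (simp add: K'_def)
  obtain C where C: "C > 0" and bound:
    "\<And>x y \<beta> \<gamma> M. 0 \<le> x \<Longrightarrow> 0 \<le> \<beta> \<Longrightarrow> 0 \<le> \<gamma> \<Longrightarrow> 1 \<le> M \<Longrightarrow> \<gamma> \<le> M \<Longrightarrow>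
      c2 * x powr s \<le> \<beta> * (x + \<gamma>) + \<gamma> * y \<Longrightarrow> y \<le> K' * (M powr (s - 2) * x + \<beta>) \<Longrightarrow>
      (x + \<gamma>) + y \<le> C * (\<beta> + M powr (s - 2) * \<beta> powr (r - 1) + \<gamma> + M powr (r * (s - 2)) * \<gamma> powr (r - 1))"
    unfolding r_def by (rule solution_difference_bound[OF s c2 K']) blast
  \<comment> \<open>The extra factor is the constant of \<open>total_norm_bound\<close>, where 3
    stems from M \<le> 3 N.\<close>
  define C' where "C' = C * (2 * 3 powr (r * (s - 2)))"
  have single: "Lp_norm s \<Omega> u \<le> B * (1 + V'_norm_pi1 s \<Omega> L powr (r - 1) + Z'_norm_pi2 s \<Omega> L)"
    if L: "L \<in> W_dual s \<Omega>" and up: "(u, p) \<in> W_space s \<Omega>" and sol: "solves_A s \<Omega> F u p L" for L u p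
  proof -
    define \<beta> \<gamma> where "\<beta> = V'_norm_pi1 s \<Omega> L" and "\<gamma> = Z'_norm_pi2 s \<Omega> L"
    have \<beta>: "\<beta> \<ge> 0" and \<gamma>: "\<gamma> \<ge> 0"
      unfolding \<beta>_def \<gamma>_def using pi1_nonneg[OF \<Omega>(1) s1 L] pi2_nonneg[OF \<Omega>(1) s1 L] by auto
    \<comment> \<open>As (r-1)(s-1) = 1, the left side is \<beta>, which gives the hypothesis on
      \<beta> in \<open>apriori\<close>.\<close>
    have "(\<beta> powr (r - 1)) powr (s - 1) \<le> (1 + \<beta> powr (r - 1) + \<gamma>) powr (s - 1)"
      using s \<gamma> by (intro powr_mono2) auto
    then have \<beta>_le: "\<beta> \<le> (1 + \<beta> powr (r - 1) + \<gamma>) powr (s - 1)" using \<beta> r(3) by (simp add: powr_powr)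
    \<comment> \<open>Against the zero solution the differences are u and p themselves, and the
      growth factor is 1 + x, as \<open>apriori\<close> requires.\<close>
    note e = est[OF L W_dual_zero up W_space_left[OF Wdiv_space_zero] sol solves_A_zero, unfolded Let_def]
    show ?thesis
      unfolding \<beta>_def[symmetric] \<gamma>_def[symmetric]
      by (rule apriori[where y="Lp_norm (s / (s - 1)) \<Omega> p" and \<beta>=\<beta> and \<gamma>=\<gamma>])
         (use e \<beta> \<gamma> \<beta>_le in \<open>auto simp: \<beta>_def[symmetric] \<gamma>_def[symmetric] add_increasing\<close>)
  qed
  have main: "d \<le> C * (\<beta> + M powr (s - 2) * \<beta> powr (r - 1) + \<gamma> + M powr (r * (s - 2)) * \<gamma> powr (r - 1)) \<and>
      d \<le> C' * (1 + W'_norm s \<Omega> L1 + W'_norm s \<Omega> L2) powr (r * (s - 2)) * (D powr (r - 1) + D)"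
    if L: "L1 \<in> W_dual s \<Omega>" "L2 \<in> W_dual s \<Omega>"
      and up: "(u1, p1) \<in> W_space s \<Omega>" "(u2, p2) \<in> W_space s \<Omega>"
      and sol: "solves_A s \<Omega> F u1 p1 L1" "solves_A s \<Omega> F u2 p2 L2"
      and M_def: "M = 1 + (V'_norm_pi1 s \<Omega> L1 powr (r - 1) + Z'_norm_pi2 s \<Omega> L1)
                 + (V'_norm_pi1 s \<Omega> L2 powr (r - 1) + Z'_norm_pi2 s \<Omega> L2)"
      and \<beta>_def: "\<beta> = V'_norm_pi1 s \<Omega> (\<lambda>w. L1 w - L2 w)"
      and \<gamma>_def: "\<gamma> = Z'_norm_pi2 s \<Omega> (\<lambda>w. L1 w - L2 w)"
      and d_def: "d = W_norm s \<Omega> (\<lambda>x. u1 x - u2 x, \<lambda>x. p1 x - p2 x)"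
      and D_def: "D = W'_norm s \<Omega> (\<lambda>w. L1 w - L2 w)"
    for L1 L2 u1 p1 u2 p2 M \<beta> \<gamma> d D
  proof -
    note \<Lambda> = W_dual_diff[OF L]
    note nonneg = pi1_nonneg[OF \<Omega>(1) s1 L(1)] pi1_nonneg[OF \<Omega>(1) s1 L(2)]
      pi2_nonneg[OF \<Omega>(1) s1 L(1)] pi2_nonneg[OF \<Omega>(1) s1 L(2)]
    have \<beta>: "0 \<le> \<beta>" "\<beta> \<le> D"
      unfolding \<beta>_def D_def by (rule pi1_nonneg[OF \<Omega>(1) s1 \<Lambda>] pi1_le_W'_norm[OF \<Omega>(1) s1 \<Lambda>])+
    have \<gamma>: "0 \<le> \<gamma>" "\<gamma> \<le> D"
      unfolding \<gamma>_def D_def by (rule pi2_nonneg[OF \<Omega>(1) s1 \<Lambda>] pi2_le_W'_norm[OF \<Omega>(1) s1 \<Lambda>])+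
    have M: "1 \<le> M" using nonneg by (simp add: M_def)
    have \<gamma>M: "\<gamma> \<le> M"
    proof -
      have "\<gamma> \<le> Z'_norm_pi2 s \<Omega> L1 + Z'_norm_pi2 s \<Omega> L2"
        unfolding \<gamma>_def by (rule pi2_diff_le[OF \<Omega>(1) s1 L])
      also have "\<dots> \<le> M"
        using powr_ge_zero[of "V'_norm_pi1 s \<Omega> L1" "r - 1"] powr_ge_zero[of "V'_norm_pi1 s \<Omega> L2" "r - 1"]
        unfolding M_def by linarith
      finally show ?thesis .
    qed
    define x y where "x = Lp_norm s \<Omega> (\<lambda>x. u1 x - u2 x)" and "y = Lp_norm (s / (s - 1)) \<Omega> (\<lambda>x. p1 x - p2 x)"
    note e = est[OF L up sol, unfolded Let_def, folded \<beta>_def \<gamma>_def x_def y_def]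
    have x: "x \<ge> 0" by (simp add: x_def)
    have u_le: "Lp_norm s \<Omega> u1 \<le> B * M" "Lp_norm s \<Omega> u2 \<le> B * M"
      using B nonneg
      by (auto intro!: order_trans[OF single[OF L(1) up(1) sol(1)]] order_trans[OF single[OF L(2) up(2) sol(2)]]
            mult_left_mono simp: M_def)
    have "1 + Lp_norm s \<Omega> u1 + Lp_norm s \<Omega> u2 \<le> (1 + 2 * B) * M"
      using u_le M by (simp add: distrib_right)
    then have "(1 + Lp_norm s \<Omega> u1 + Lp_norm s \<Omega> u2) powr (s - 2) \<le> ((1 + 2 * B) * M) powr (s - 2)"
      using s by (intro powr_mono2) (auto simp: add_nonneg_nonneg)
    also have "\<dots> = (1 + 2 * B) powr (s - 2) * M powr (s - 2)"
      using B M by (simp add: powr_mult)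
    finally have H: "(1 + Lp_norm s \<Omega> u1 + Lp_norm s \<Omega> u2) powr (s - 2) * x
        \<le> (1 + 2 * B) powr (s - 2) * M powr (s - 2) * x"
      using x by (intro mult_right_mono)
    have "y \<le> K * ((1 + 2 * B) powr (s - 2) * M powr (s - 2) * x + \<beta>)"
      using e K H by (smt (verit) mult_left_mono)
    also have "\<dots> \<le> K * (((1 + 2 * B) powr (s - 2) + 1) * (M powr (s - 2) * x + \<beta>))"
      using K x \<beta> by (intro mult_left_mono) (auto simp: algebra_simps)
    finally have y: "y \<le> K' * (M powr (s - 2) * x + \<beta>)" by (simp add: K'_def mult.assoc)
    have "d \<le> (x + \<gamma>) + y" using e by (simp add: d_def W_norm_def y_def)
    also have "\<dots> \<le> C * (\<beta> + M powr (s - 2) * \<beta> powr (r - 1) + \<gamma> + M powr (r * (s - 2)) * \<gamma> powr (r - 1))"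
      using bound[OF x \<beta>(1) \<gamma>(1) M \<gamma>M _ y] e by blast
    finally have first: "d \<le> C * (\<beta> + M powr (s - 2) * \<beta> powr (r - 1) + \<gamma> + M powr (r * (s - 2)) * \<gamma> powr (r - 1))" .
    define N where "N = 1 + W'_norm s \<Omega> L1 + W'_norm s \<Omega> L2"
    have N: "1 \<le> N"
      using W'_norm_nonneg[OF \<Omega>(1) s1 L(1)] W'_norm_nonneg[OF \<Omega>(1) s1 L(2)] by (simp add: N_def)
    have r': "0 \<le> r - 1" "r - 1 \<le> 1" using r by auto
    have M_summand: "V'_norm_pi1 s \<Omega> L powr (r - 1) + Z'_norm_pi2 s \<Omega> L \<le> 1 + 2 * W'_norm s \<Omega> L"
      if "L \<in> W_dual s \<Omega>" for L
      using powr_le_one_plus[OF pi1_nonneg[OF \<Omega>(1) s1 that] r']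
        pi1_le_W'_norm[OF \<Omega>(1) s1 that] pi2_le_W'_norm[OF \<Omega>(1) s1 that] by simp
    \<comment> \<open>The two summands contribute 1 each besides the leading 1 of M, so M is at most
      3 plus twice the sum of the W' norms.\<close>
    have "M \<le> 3 * N"
      using M_summand[OF L(1)] M_summand[OF L(2)]
        W'_norm_nonneg[OF \<Omega>(1) s1 L(1)] W'_norm_nonneg[OF \<Omega>(1) s1 L(2)]
      by (simp add: M_def N_def)
    with M N have "\<beta> + M powr (s - 2) * \<beta> powr (r - 1) + \<gamma> + M powr (r * (s - 2)) * \<gamma> powr (r - 1)
        \<le> 2 * 3 powr (r * (s - 2)) * N powr (r * (s - 2)) * (D powr (r - 1) + D)"
      unfolding r_def using \<beta> \<gamma> by (intro total_norm_bound[OF s]) auto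
    with C have "d \<le> C * (2 * 3 powr (r * (s - 2)) * N powr (r * (s - 2)) * (D powr (r - 1) + D))"
      by (intro order_trans[OF first] mult_left_mono) auto
    with first show ?thesis by (simp add: C'_def N_def mult.assoc)
  qed
  show ?thesis
  proof (rule exI[of _ C], rule exI[of _ C'], intro conjI allI impI)
    show "C > 0" by (rule C)
    show "C' > 0" using C by (simp add: C'_def)
  qed (unfold Let_def, fold r_def, rule main, assumption+, rule refl, rule refl, rule refl, rule refl, rule refl)
qed

end
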